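(* Let $\xi$ be a boundedly exchangeable graph process on $S$, directed by $\nu$ and connected by a connection kernel $W:S^2\to[0,1]$. For any bounded Borel set $B\subseteq S$ with $\mathbb{P}(\nu(B)=0)<1$, there exists a graphon $W_B:[0,1]^2\to[0,1]$ (a symmetric measurable function) such that every exchangeable matrix $A^B$ associated with $\xi$ on $B$ admits a representation $$A^B_{ij}\overset{a.s.}{=}\mathbf{1}\{U_{ij}\le W_B(U_i,U_j)\},\qquad i,j\in\mathbb{N},$$ where $(U_i)_{i\in\mathbb{N}}$ and $(U_{ij})_{i,j\in\mathbb{N}}$ with $U_{ij}=U_{ji}$ are independent arrays of i.i.d. uniform random variables on $[0,1]$.
   Context: $\mathbb{N}=\{1,2,\dots\}$. Let $(S,d)$ be a complete separable metric space; "bounded" means bounded for $d$. A measure is locally finite if it is finite on bounded Borel sets, and simple if it is a locally finite countable sum of distinct unit point masses. All random elements live on a common probability space assumed rich enough that a distributional representation in terms of independent uniform variables can be realised almost surely. An adjacency measure on $S$ is a simple measure $\xi$ on $S^2\times\{0,1\}$ such that there is a simple measure $\nu$ on $S$ with $\xi(C\times\{0,1\})=\nu^{\otimes2}(C)$ for all Borel $C\subseteq S^2$, and $\xi$ is invariant under $(x,y,a)\mapsto(y,x,a)$; $\xi$ is directed by the (unique) $\nu$. For Borel $B$, $\xi|_B$ is the restriction of $\xi$ to $B\times B\times\{0,1\}$. A random adjacency measure is a random measure that is a.s. an adjacency measure; it has representations $$\xi\overset{a.s.}{=}\sum_{i,j\le N}\delta_{(S_i,S_j,A_{ij})}\qquad(\ast)$$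 with $N$ a random variable in $\{0,1,\dots\}\cup\{\infty\}$, $(S_i)_{i\le N}$ a.s. distinct random elements of $S$, and $A=(A_{ij})_{i,j\le N}$ a symmetric $\{0,1\}$-valued array (the adjacency matrix). A connection kernel is a symmetric measurable $W:S^2\to[0,1]$. A random adjacency measure is a graph process connected by $W$ if it admits a representation $(\ast)$ in which, conditionally on $(N,(S_k))$, $A_{ii}=0$, the $A_{ij}$, $i<j$, are independent $\mathrm{Bernoulli}(W(S_i,S_j))$, and $A_{ji}=A_{ij}$. It is an i.i.d. representation if in addition the $(S_k)$ are i.i.d. and $N$ is independent of $(S_k)$. A mixed binomial process is a point process equal in law to $\sum_{i\le N}\delta_{S_i}$ with $N$ an a.s. finite $\{0,1,\dots\}$-valued random variable independent of an i.i.d. sequence $(S_i)$. A mixed Poisson process is, conditionally on a random variable $\delta\ge0$, a Poisson process with intensity measure $\delta\mu$, $\mu$ locally finite. A graph process $\xi$ is boundedly exchangeable if it is directed by a mixed Poisson or mixed binomial process $\nu$ and, for every bounded Borel $B$ with $\mathbb{P}(\nu(B)=0)<1$, $\mathbb{P}(\nu(B)=n)>0$ for all $n\in\mathbb{N}$. For such $\xi$ and $B$ there is a unique distribution of an infinite jointly exchangeable random matrix $A^B$ (i.e. with law invariant under simultaneous finite permutations of rows and columns) such that the adjacency matrix $(A,N)$ of any i.i.d. representation of $\xi|_B$ satisfies $A\mid(N=n)\overset{d}{=}(A^B_{ij})_{i,j\le n}$ for all $n\ge1$; any random matrix with this distribution is called an exchangeable matrix associated with $\xi$ on $B$. *)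

theory Defs
  imports "HOL-Probability.Probability" "HOL-Combinatorics.Permutations"
begin

subsection \<open>Simple measures and random measures\<close>

text \<open>
  The sum over \<open>i \<in> I\<close> of the unit masses at \<open>f i\<close> is the image of counting measure on \<open>I\<close>.
\<close>

definition point_masses :: "'i set \<Rightarrow> 'b measure \<Rightarrow> ('i \<Rightarrow> 'b) \<Rightarrow> 'b measure" where
  "point_masses I K f = distr (count_space I) K f"

text \<open>
  The argument \<open>bdd\<close> says which subsets of the underlying space count as bounded.
\<close>

definition locally_finite :: "('b set \<Rightarrow> bool) \<Rightarrow> 'b measure \<Rightarrow> bool" where
  "locally_finite bdd \<mu> \<longleftrightarrow> (\<forall>C\<in>sets \<mu>. bdd C \<longrightarrow> emeasure \<mu> C < \<infinity>)"

definition simple_measure :: "'b measure \<Rightarrow> ('b set \<Rightarrow> bool) \<Rightarrow> 'b measure \<Rightarrow> bool" where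
  "simple_measure K bdd \<mu> \<longleftrightarrow>
     locally_finite bdd \<mu> \<and> (\<exists>X. countable X \<and> X \<subseteq> space K \<and> \<mu> = point_masses X K (\<lambda>x. x))"

text \<open>
  The sigma-algebra generated by the evaluations \<open>\<mu> \<mapsto> \<mu> C\<close>, as for \<open>subprob_algebra\<close> but without
  a bound on the total mass; random measures are the measurable maps into it.
\<close>

definition measure_algebra :: "'b measure \<Rightarrow> 'b measure measure" where
  "measure_algebra K =
     (SUP C \<in> sets K. vimage_algebra {\<mu>. sets \<mu> = sets K} (\<lambda>\<mu>. emeasure \<mu> C) borel)"

text \<open>
  The library's \<open>indep_var\<close> requires both random elements to take values in the same type, so
  independence is stated for the sigma-algebras they generate.
\<close>

definition independent_elements ::
    "'w measure \<Rightarrow> 'b measure \<Rightarrow> ('w \<Rightarrow> 'b) \<Rightarrow> 'c measure \<Rightarrow> ('w \<Rightarrow> 'c) \<Rightarrow> bool" where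
  "independent_elements M K X L Y \<longleftrightarrow>
     X \<in> M \<rightarrow>\<^sub>M K \<and> Y \<in> M \<rightarrow>\<^sub>M L \<and>
     prob_space.indep_set M (sets (vimage_algebra (space M) X K)) (sets (vimage_algebra (space M) Y L))"

subsection \<open>Adjacency measures\<close>

text \<open>
  The set \<open>{0, 1}\<close> is rendered by \<^typ>\<open>bool\<close>. As \<open>S\<close> is second countable, the product
  sigma-algebra below is the Borel sigma-algebra of \<open>S\<^sup>2 \<times> {0, 1}\<close>.
\<close>

abbreviation edge_space :: "(('a::polish_space \<times> 'a) \<times> bool) measure" where
  "edge_space \<equiv> (borel \<Otimes>\<^sub>M borel) \<Otimes>\<^sub>M count_space UNIV"

definition directed_by ::
    "(('a::polish_space \<times> 'a) \<times> bool) measure \<Rightarrow> 'a measure \<Rightarrow> bool" where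
  "directed_by \<xi> \<nu> \<longleftrightarrow> simple_measure borel bounded \<nu> \<and>
     (\<forall>C\<in>sets (borel \<Otimes>\<^sub>M borel). emeasure \<xi> (C \<times> UNIV) = emeasure (\<nu> \<Otimes>\<^sub>M \<nu>) C)"

definition adjacency_measure :: "(('a::polish_space \<times> 'a) \<times> bool) measure \<Rightarrow> bool" where
  "adjacency_measure \<xi> \<longleftrightarrow>
     simple_measure edge_space (\<lambda>C. bounded (fst ` C)) \<xi> \<and>
     (\<exists>\<nu>. directed_by \<xi> \<nu>) \<and>
     distr \<xi> edge_space (\<lambda>((x, y), a). ((y, x), a)) = \<xi>"

definition restrict_adjacency ::
    "(('a::polish_space \<times> 'a) \<times> bool) measure \<Rightarrow> 'a set \<Rightarrow> (('a \<times> 'a) \<times> bool) measure" where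
  "restrict_adjacency \<xi> B = density \<xi> (indicator ((B \<times> B) \<times> UNIV))"

definition random_adjacency_measure ::
    "'w measure \<Rightarrow> ('w \<Rightarrow> (('a::polish_space \<times> 'a) \<times> bool) measure) \<Rightarrow> bool" where
  "random_adjacency_measure M \<xi> \<longleftrightarrow>
     \<xi> \<in> M \<rightarrow>\<^sub>M measure_algebra edge_space \<and> (AE \<omega> in M. adjacency_measure (\<xi> \<omega>))"

subsection \<open>Representations and graph processes\<close>

abbreviation matrix_space :: "(nat \<times> nat \<Rightarrow> bool) measure" where
  "matrix_space \<equiv> PiM UNIV (\<lambda>_. count_space UNIV)"

text \<open>
  Points are indexed from 0, so \<open>i \<le> N\<close> for \<open>i\<close> in \<open>{1, 2, \<dots>}\<close> becomes \<open>i < N\<close>. The points and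
  the matrix are total arrays; only their entries with indices below \<open>N\<close> are constrained here.
\<close>

definition adjacency_representation ::
    "'w measure \<Rightarrow> ('w \<Rightarrow> (('a::polish_space \<times> 'a) \<times> bool) measure) \<Rightarrow>
     ('w \<Rightarrow> enat) \<Rightarrow> ('w \<Rightarrow> nat \<Rightarrow> 'a) \<Rightarrow> ('w \<Rightarrow> nat \<times> nat \<Rightarrow> bool) \<Rightarrow> bool" where
  "adjacency_representation M \<xi> N S A \<longleftrightarrow>
     N \<in> M \<rightarrow>\<^sub>M count_space UNIV \<and>
     S \<in> M \<rightarrow>\<^sub>M PiM UNIV (\<lambda>_. borel) \<and>
     A \<in> M \<rightarrow>\<^sub>M matrix_space \<and>
     (AE \<omega> in M. inj_on (S \<omega>) {i. enat i < N \<omega>}) \<and>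
     (AE \<omega> in M. \<forall>i j. enat i < N \<omega> \<and> enat j < N \<omega> \<longrightarrow> A \<omega> (i, j) = A \<omega> (j, i)) \<and>
     (AE \<omega> in M. \<xi> \<omega> = point_masses {(i, j). enat i < N \<omega> \<and> enat j < N \<omega>} edge_space
                        (\<lambda>(i, j). ((S \<omega> i, S \<omega> j), A \<omega> (i, j))))"

definition connection_kernel :: "('a::polish_space \<times> 'a \<Rightarrow> real) \<Rightarrow> bool" where
  "connection_kernel W \<longleftrightarrow>
     W \<in> borel_measurable (borel \<Otimes>\<^sub>M borel) \<and>
     (\<forall>x y. W (x, y) = W (y, x) \<and> 0 \<le> W (x, y) \<and> W (x, y) \<le> 1)"

text \<open>
  Conditional independence of the Bernoulli entries given \<open>(N, S)\<close> is stated through the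
  conditional probabilities of all configurations \<open>a\<close> of the entries above the diagonal of the
  \<open>n \<times> n\<close> corners with \<open>n \<le> N\<close>; for \<open>N = \<infinity>\<close> these are all finite corners.
\<close>

definition graph_representation ::
    "'w measure \<Rightarrow> ('a::polish_space \<times> 'a \<Rightarrow> real) \<Rightarrow> ('w \<Rightarrow> (('a \<times> 'a) \<times> bool) measure) \<Rightarrow>
     ('w \<Rightarrow> enat) \<Rightarrow> ('w \<Rightarrow> nat \<Rightarrow> 'a) \<Rightarrow> ('w \<Rightarrow> nat \<times> nat \<Rightarrow> bool) \<Rightarrow> bool" where
  "graph_representation M W \<xi> N S A \<longleftrightarrow>
     adjacency_representation M \<xi> N S A \<and>
     (AE \<omega> in M. \<forall>i. enat i < N \<omega> \<longrightarrow> \<not> A \<omega> (i, i)) \<and>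
     (\<forall>n a. AE \<omega> in M. enat n \<le> N \<omega> \<longrightarrow>
        real_cond_exp M
          (vimage_algebra (space M) (\<lambda>\<omega>. (N \<omega>, S \<omega>)) (count_space UNIV \<Otimes>\<^sub>M PiM UNIV (\<lambda>_. borel)))
          (indicator {\<omega> \<in> space M. \<forall>i j. i < j \<and> j < n \<longrightarrow> A \<omega> (i, j) = a (i, j)}) \<omega>
        = (\<Prod>(i, j)\<in>{(i, j). i < j \<and> j < n}.
             if a (i, j) then W (S \<omega> i, S \<omega> j) else 1 - W (S \<omega> i, S \<omega> j)))"

definition graph_process ::
    "'w measure \<Rightarrow> ('a::polish_space \<times> 'a \<Rightarrow> real) \<Rightarrow> ('w \<Rightarrow> (('a \<times> 'a) \<times> bool) measure) \<Rightarrow> bool"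
  where
  "graph_process M W \<xi> \<longleftrightarrow>
     connection_kernel W \<and> random_adjacency_measure M \<xi> \<and>
     (\<exists>N S A. graph_representation M W \<xi> N S A)"

definition iid_representation ::
    "'w measure \<Rightarrow> ('a::polish_space \<times> 'a \<Rightarrow> real) \<Rightarrow> ('w \<Rightarrow> (('a \<times> 'a) \<times> bool) measure) \<Rightarrow>
     ('w \<Rightarrow> enat) \<Rightarrow> ('w \<Rightarrow> nat \<Rightarrow> 'a) \<Rightarrow> ('w \<Rightarrow> nat \<times> nat \<Rightarrow> bool) \<Rightarrow> bool" where
  "iid_representation M W \<xi> N S A \<longleftrightarrow>
     graph_representation M W \<xi> N S A \<and>
     prob_space.indep_vars M (\<lambda>_. borel) (\<lambda>k \<omega>. S \<omega> k) UNIV \<and>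
     (\<forall>k. distr M borel (\<lambda>\<omega>. S \<omega> k) = distr M borel (\<lambda>\<omega>. S \<omega> 0)) \<and>
     independent_elements M (count_space UNIV) N (PiM UNIV (\<lambda>_. borel)) S"

subsection \<open>Boundedly exchangeable graph processes\<close>

text \<open>
  The right-hand side is the law of the random sum of point masses realised on a product space,
  with \<open>p\<close> the law of the number of points and \<open>\<mu>\<close> the law of a single point.
\<close>

definition mixed_binomial_process ::
    "'w measure \<Rightarrow> ('w \<Rightarrow> 'a::polish_space measure) \<Rightarrow> bool" where
  "mixed_binomial_process M \<nu> \<longleftrightarrow>
     \<nu> \<in> M \<rightarrow>\<^sub>M measure_algebra borel \<and>
     (\<exists>(p :: nat pmf) \<mu>. prob_space \<mu> \<and> sets \<mu> = sets borel \<and>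
        distr M (measure_algebra borel) \<nu>
        = distr (measure_pmf p \<Otimes>\<^sub>M PiM (UNIV :: nat set) (\<lambda>_. \<mu>)) (measure_algebra borel)
            (\<lambda>(n, s). point_masses {..<n} borel s))"

text \<open>
  Poisson weights are written out, since \<open>poisson_pmf\<close> excludes the rate 0.
\<close>

definition mixed_poisson_process ::
    "'w measure \<Rightarrow> ('w \<Rightarrow> 'a::polish_space measure) \<Rightarrow> bool" where
  "mixed_poisson_process M \<nu> \<longleftrightarrow>
     \<nu> \<in> M \<rightarrow>\<^sub>M measure_algebra borel \<and>
     (\<exists>(\<delta> :: 'w \<Rightarrow> real) \<mu>.
        \<delta> \<in> borel_measurable M \<and> (AE \<omega> in M. 0 \<le> \<delta> \<omega>) \<and>
        sets \<mu> = sets borel \<and> locally_finite bounded \<mu> \<and>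
        (\<forall>m (C :: nat \<Rightarrow> 'a set) (k :: nat \<Rightarrow> nat).
           (\<forall>i<m. C i \<in> sets borel \<and> bounded (C i)) \<and> disjoint_family_on C {..<m} \<longrightarrow>
           (AE \<omega> in M.
              real_cond_exp M (vimage_algebra (space M) \<delta> borel)
                (indicator {\<omega> \<in> space M. \<forall>i<m. emeasure (\<nu> \<omega>) (C i) = of_nat (k i)}) \<omega>
              = (\<Prod>i<m. (\<delta> \<omega> * measure \<mu> (C i)) ^ k i / fact (k i)
                         * exp (- (\<delta> \<omega> * measure \<mu> (C i)))))))"

definition boundedly_exchangeable ::
    "'w measure \<Rightarrow> ('a::polish_space \<times> 'a \<Rightarrow> real) \<Rightarrow> ('w \<Rightarrow> (('a \<times> 'a) \<times> bool) measure) \<Rightarrow>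
     ('w \<Rightarrow> 'a measure) \<Rightarrow> bool" where
  "boundedly_exchangeable M W \<xi> \<nu> \<longleftrightarrow>
     graph_process M W \<xi> \<and>
     (AE \<omega> in M. directed_by (\<xi> \<omega>) (\<nu> \<omega>)) \<and>
     (mixed_poisson_process M \<nu> \<or> mixed_binomial_process M \<nu>) \<and>
     (\<forall>B\<in>sets borel. bounded B \<and> \<P>(\<omega> in M. emeasure (\<nu> \<omega>) B = 0) < 1 \<longrightarrow>
        (\<forall>n\<ge>1. \<P>(\<omega> in M. emeasure (\<nu> \<omega>) B = of_nat n) > 0))"

subsection \<open>Associated exchangeable matrices\<close>

definition jointly_exchangeable_law :: "(nat \<times> nat \<Rightarrow> bool) measure \<Rightarrow> bool" where
  "jointly_exchangeable_law D \<longleftrightarrow>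
     prob_space D \<and> sets D = sets matrix_space \<and>
     (\<forall>\<pi> I. finite I \<and> \<pi> permutes I \<longrightarrow> distr D matrix_space (\<lambda>a (i, j). a (\<pi> i, \<pi> j)) = D)"

abbreviation corner :: "nat \<Rightarrow> (nat \<times> nat \<Rightarrow> bool) \<Rightarrow> (nat \<times> nat \<Rightarrow> bool)" where
  "corner n a \<equiv> restrict a ({..<n} \<times> {..<n})"

abbreviation corner_space :: "nat \<Rightarrow> (nat \<times> nat \<Rightarrow> bool) measure" where
  "corner_space n \<equiv> PiM ({..<n} \<times> {..<n}) (\<lambda>_. count_space UNIV)"

text \<open>
  The law of \<open>A\<close> given \<open>N = n\<close> is the image of \<open>M\<close> conditioned on that event, and
  \<open>uniform_measure\<close> is conditioning on an event.
\<close>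

definition matches_representations ::
    "'w measure \<Rightarrow> ('a::polish_space \<times> 'a \<Rightarrow> real) \<Rightarrow> ('w \<Rightarrow> (('a \<times> 'a) \<times> bool) measure) \<Rightarrow>
     'a set \<Rightarrow> (nat \<times> nat \<Rightarrow> bool) measure \<Rightarrow> bool" where
  "matches_representations M W \<xi> B D \<longleftrightarrow>
     jointly_exchangeable_law D \<and>
     (\<forall>N S A. iid_representation M W (\<lambda>\<omega>. restrict_adjacency (\<xi> \<omega>) B) N S A \<longrightarrow>
        (\<forall>n\<ge>1. distr (uniform_measure M {\<omega> \<in> space M. N \<omega> = enat n}) (corner_space n)
                   (\<lambda>\<omega>. corner n (A \<omega>))
               = distr D (corner_space n) (corner n)))"

definition associated_matrix ::
    "'w measure \<Rightarrow> ('a::polish_space \<times> 'a \<Rightarrow> real) \<Rightarrow> ('w \<Rightarrow> (('a \<times> 'a) \<times> bool) measure) \<Rightarrow>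
     'a set \<Rightarrow> ('w \<Rightarrow> nat \<times> nat \<Rightarrow> bool) \<Rightarrow> bool" where
  "associated_matrix M W \<xi> B A \<longleftrightarrow>
     A \<in> M \<rightarrow>\<^sub>M matrix_space \<and>
     (\<exists>!D. matches_representations M W \<xi> B D) \<and>
     matches_representations M W \<xi> B (distr M matrix_space A)"

subsection \<open>Uniform arrays and graphons\<close>

definition iid_uniform :: "'w measure \<Rightarrow> ('i \<Rightarrow> 'w \<Rightarrow> real) \<Rightarrow> 'i set \<Rightarrow> bool" where
  "iid_uniform M U I \<longleftrightarrow>
     prob_space.indep_vars M (\<lambda>_. borel) U I \<and>
     (\<forall>i\<in>I. distr M borel (U i) = uniform_measure lborel {0..1})"

text \<open>
  A distributional representation \<open>X =\<^sub>d f(U\<^sub>0, U\<^sub>1, \<dots>)\<close> in independent uniform variables can be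
  realised almost surely on \<open>M\<close>. The state space of real sequences stands for all standard Borel
  spaces, each of which embeds into it as a Borel subset.
\<close>

definition rich :: "'w measure \<Rightarrow> bool" where
  "rich M \<longleftrightarrow>
     (\<forall>(X :: 'w \<Rightarrow> nat \<Rightarrow> real) (f :: (nat \<Rightarrow> real) \<Rightarrow> nat \<Rightarrow> real).
        X \<in> M \<rightarrow>\<^sub>M PiM UNIV (\<lambda>_. borel) \<and>
        f \<in> PiM UNIV (\<lambda>_. borel) \<rightarrow>\<^sub>M PiM UNIV (\<lambda>_. borel) \<and>
        distr M (PiM UNIV (\<lambda>_. borel)) X
          = distr (PiM UNIV (\<lambda>_. uniform_measure lborel {0..1})) (PiM UNIV (\<lambda>_. borel)) f \<longrightarrow>
        (\<exists>U :: nat \<Rightarrow> 'w \<Rightarrow> real. iid_uniform M U UNIV \<and> (AE \<omega> in M. X \<omega> = f (\<lambda>k. U k \<omega>))))"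

definition graphon :: "(real \<times> real \<Rightarrow> real) \<Rightarrow> bool" where
  "graphon w \<longleftrightarrow>
     w \<in> borel_measurable (restrict_space (borel \<Otimes>\<^sub>M borel) ({0..1} \<times> {0..1})) \<and>
     (\<forall>x\<in>{0..1}. \<forall>y\<in>{0..1}. w (x, y) = w (y, x) \<and> 0 \<le> w (x, y) \<and> w (x, y) \<le> 1)"

text \<open>
  Because of the symmetry \<open>V\<^sub>i\<^sub>j = V\<^sub>j\<^sub>i\<close>, independence within \<open>V\<close> concerns the entries with \<open>i \<le> j\<close>.
\<close>

definition uniform_arrays ::
    "'w measure \<Rightarrow> (nat \<Rightarrow> 'w \<Rightarrow> real) \<Rightarrow> (nat \<times> nat \<Rightarrow> 'w \<Rightarrow> real) \<Rightarrow> bool" where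
  "uniform_arrays M U V \<longleftrightarrow>
     iid_uniform M U UNIV \<and>
     iid_uniform M V {(i, j). i \<le> j} \<and> (\<forall>i j. V (i, j) = V (j, i)) \<and>
     independent_elements M (PiM UNIV (\<lambda>_. borel)) (\<lambda>\<omega> i. U i \<omega>)
                            (PiM UNIV (\<lambda>_. borel)) (\<lambda>\<omega> p. V p \<omega>)"

end

theory Submission
  imports Defs
begin

text \<open>
  Suppose that \<open>\<xi>\<close> restricted to \<open>B\<close> has an i.i.d. representation \<open>(N, S, A)\<close>, and let \<open>\<mu>\<close> be the law
  of \<open>S 0\<close>. Given \<open>N = n\<close>, independence of \<open>N\<close> and \<open>S\<close> leaves \<open>S\<close> i.i.d. with law \<open>\<mu>\<close>, so the entries
  of the \<open>n \<times> n\<close> corner above the diagonal are Bernoulli with the parameters \<open>W (S i, S j)\<close> of an i.i.d.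
  sequence (\<open>iid_representation_upper_probability\<close>). Hence every associated matrix samples from \<open>W\<close> at
  i.i.d. points of law \<open>\<mu>\<close>. A Polish space embeds into the line as a Borel set, so \<open>\<mu>\<close> is the law of
  \<open>h u\<close> for a Borel \<open>h\<close> and a uniform \<open>u\<close> (\<open>uniform_realisation\<close>: an embedding by digits,
  then the quantile function). The graphon is therefore \<open>W (h x, h y)\<close>, set to \<open>0\<close> on the diagonal \<open>x = y\<close>:
  the diagonal entries of the matrix compare a uniform variable with \<open>W\<^sub>B (U i, U i)\<close>, and they have to
  vanish because a graph process has no loops; off the diagonal the change is invisible, since distinct
  uniform variables are almost surely different.

  Comparing \<open>\<one>{V (i, j) \<le> W\<^sub>B (U i, U j)}\<close> with the matrix of the representation needs
  only the configurations above the diagonal (\<open>corner_law_eqI\<close>), where Fubini turns the thresholds into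
  the same product of Bernoulli weights (\<open>bernoulli_thresholds\<close>). The corners determine the law of the
  whole array (\<open>matrix_law_eqI\<close>), and richness of \<open>M\<close> upgrades equality in law to almost sure equality
  (\<open>rich_realises_matrix_law\<close>).

  An i.i.d. representation exists whenever there is an associated matrix at all. Otherwise every jointly
  exchangeable law would match all representations vacuously, against the uniqueness that is part of being
  associated (\<open>unique_match_imp_representation\<close>). In the same way a matching law gives positive
  probability to each event \<open>N = n\<close>, because conditioning on a null event yields the null measure, which
  is not the law of a corner (\<open>matches_representations_positive\<close>).
\<close>

section \<open>Borel maps from the unit interval onto Polish laws\<close>

text \<open>
  The point of half the middle-thirds Cantor set with digits \<open>b\<close>: with digits \<open>0\<close> and \<open>1\<close> only,
  the tail of the expansion is at most half a unit of the current place, so digits can be read off by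
  comparison.
\<close>

definition ternary :: "(nat \<Rightarrow> bool) \<Rightarrow> real" where
  "ternary b = (\<Sum>n. of_bool (b n) / 3 ^ Suc n)"

fun ternary_digit :: "nat \<Rightarrow> real \<Rightarrow> bool" where
  "ternary_digit 0 t \<longleftrightarrow> 1 / 3 \<le> t"
| "ternary_digit (Suc n) t \<longleftrightarrow> ternary_digit n (3 * t - of_bool (1 / 3 \<le> t))"

lemma third_powers_sums: "(\<lambda>n. 1 / 3 ^ Suc n :: real) sums (1 / 2)"
proof -
  have "(\<lambda>n. (1 / 3) * (1 / 3) ^ n :: real) sums ((1 / 3) * (1 / (1 - 1 / 3)))"
    by (intro sums_mult geometric_sums) simp
  then show ?thesis by (simp add: power_divide)
qed

lemma ternary_summable: "summable (\<lambda>n. of_bool (b n) / 3 ^ Suc n :: real)"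
  by (rule summable_comparison_test'[OF sums_summable[OF third_powers_sums], of 0]) auto

lemma ternary_bounds: "0 \<le> ternary b" "ternary b \<le> 1 / 2"
proof -
  show "0 \<le> ternary b"
    unfolding ternary_def by (intro suminf_nonneg ternary_summable) simp
  have "ternary b \<le> (\<Sum>n. 1 / 3 ^ Suc n)"
    unfolding ternary_def
    by (intro suminf_le ternary_summable sums_summable[OF third_powers_sums]) auto
  then show "ternary b \<le> 1 / 2"
    using sums_unique[OF third_powers_sums] by simp
qed

lemma ternary_rec: "ternary b = of_bool (b 0) / 3 + ternary (\<lambda>n. b (Suc n)) / 3"
proof -
  have "ternary b = (\<Sum>n. of_bool (b (Suc n)) / 3 ^ Suc (Suc n)) + of_bool (b 0) / 3"
    unfolding ternary_def using suminf_split_head[OF ternary_summable[of b]] by simp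
  also have "(\<Sum>n. of_bool (b (Suc n)) / 3 ^ Suc (Suc n)) = ternary (\<lambda>n. b (Suc n)) / 3"
    unfolding ternary_def
    by (subst suminf_divide[symmetric]) (use ternary_summable[of "\<lambda>n. b (Suc n)"] in \<open>auto simp: mult.commute mult.left_commute\<close>)
  finally show ?thesis by simp
qed

text \<open>
  The expansion is \<open>b 0 / 3\<close> plus at most \<open>1 / 6\<close>, so comparison with \<open>1 / 3\<close> reveals \<open>b 0\<close>, and
  subtracting that digit and scaling by \<open>3\<close> shifts the sequence.
\<close>

lemma ternary_digit_ternary: "ternary_digit n (ternary b) = b n"
proof (induction n arbitrary: b)
  case 0
  show ?case
    using ternary_rec[of b] ternary_bounds[of "\<lambda>n. b (Suc n)"] by (cases "b 0") auto
next
  case (Suc n)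
  have "1 / 3 \<le> ternary b \<longleftrightarrow> b 0"
    using ternary_rec[of b] ternary_bounds[of "\<lambda>n. b (Suc n)"] by (cases "b 0") auto
  then have "3 * ternary b - of_bool (1 / 3 \<le> ternary b) = ternary (\<lambda>n. b (Suc n))"
    using ternary_rec[of b] by simp
  then show ?case using Suc by simp
qed

lemma measurable_ternary_digit [measurable]: "Measurable.pred borel (ternary_digit n)"
proof (induction n)
  case (Suc n)
  note Suc [measurable]
  show ?case by simp
qed simp

text \<open>
  A point is determined by the bits \<open>dist x (q k) < 2\<^sup>-\<^sup>n\<close>, where \<open>q\<close> enumerates a dense set: for each \<open>n\<close>
  let \<open>k\<close> be the first index whose bit is set, then \<open>q k\<close> tends to \<open>x\<close>. Thus \<open>\<phi>\<close> encodes the bits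
  in one real number and \<open>g\<close> decodes them and takes the limit, which completeness provides on the
  measurable set where the approximations form a Cauchy sequence.
\<close>

lemma borel_section_of_reals:
  obtains \<phi> :: "'a::polish_space \<Rightarrow> real" and g :: "real \<Rightarrow> 'a"
  where "\<phi> \<in> borel_measurable borel" "g \<in> borel_measurable borel" "\<And>x. g (\<phi> x) = x"
proof -
  obtain D :: "'a set" where D: "countable D" "\<And>X. open X \<Longrightarrow> X \<noteq> {} \<Longrightarrow> \<exists>d\<in>D. d \<in> X"
    using countable_dense_setE by blast
  define q where "q = from_nat_into D"
  have near: "\<exists>k. dist x (q k) < e" if "0 < e" for x :: 'a and e
  proof -
    obtain d where d: "d \<in> D" "d \<in> ball x e"
      using D(2)[of "ball x e"] \<open>0 < e\<close> by force
    then obtain k where "q k = d"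
      unfolding q_def using D(1) from_nat_into_surj by metis
    with d show ?thesis by auto
  qed
  define close where "close x p = (case prod_decode p of (n, k) \<Rightarrow> dist x (q k) < (1 / 2) ^ n)" for x p
  define \<phi> where "\<phi> x = ternary (close x)" for x
  define a where "a n t = q (LEAST k. ternary_digit (prod_encode (n, k)) t)" for n t
  define g where "g t = lim (\<lambda>n. if Cauchy (\<lambda>n. a n t) then a n t else q 0)" for t
  have [measurable]: "Measurable.pred borel (\<lambda>x. close x p)" for p
    unfolding close_def by (cases "prod_decode p") simp
  have "\<phi> \<in> borel_measurable borel"
    unfolding \<phi>_def ternary_def by measurable
  moreover have "g \<in> borel_measurable borel"
  proof (rule borel_measurable_LIMSEQ_metric)
    have [measurable]: "a n \<in> borel_measurable borel" for n
      unfolding a_def by (rule measurable_compose[of _ _ "count_space UNIV"]) measurable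
    show "(\<lambda>t. if Cauchy (\<lambda>n. a n t) then a n t else q 0) \<in> borel_measurable borel" for n
      using sets_Collect_Cauchy[of a borel] by (intro measurable_If) auto
    fix t
    have "convergent (\<lambda>n. if Cauchy (\<lambda>n. a n t) then a n t else q 0)"
      by (cases "Cauchy (\<lambda>n. a n t)") (auto intro: Cauchy_convergent convergent_const)
    then show "(\<lambda>n. if Cauchy (\<lambda>n. a n t) then a n t else q 0) \<longlonglongrightarrow> g t"
      unfolding g_def by (simp add: convergent_LIMSEQ_iff)
  qed
  moreover have "g (\<phi> x) = x" for x
  proof -
    have "dist x (a n (\<phi> x)) < (1 / 2) ^ n" for n
    proof -
      have "a n (\<phi> x) = q (LEAST k. dist x (q k) < (1 / 2) ^ n)"
        unfolding a_def \<phi>_def by (simp add: ternary_digit_ternary close_def)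
      moreover have "dist x (q (LEAST k. dist x (q k) < (1 / 2) ^ n)) < (1 / 2) ^ n"
        by (rule LeastI_ex) (simp add: near)
      ultimately show ?thesis by simp
    qed
    then have bound: "dist (a n (\<phi> x)) x \<le> (1 / 2) ^ n" for n
      by (metis dist_commute less_imp_le)
    have "(\<lambda>n. dist (a n (\<phi> x)) x) \<longlonglongrightarrow> 0"
    proof (rule tendsto_sandwich[where f = "\<lambda>_. 0" and h = "\<lambda>n. (1 / 2) ^ n"])
      show "(\<lambda>n. (1 / 2) ^ n :: real) \<longlonglongrightarrow> 0"
        by (rule LIMSEQ_power_zero) simp
    qed (simp_all add: bound)
    then have lim: "(\<lambda>n. a n (\<phi> x)) \<longlonglongrightarrow> x"
      by (rule iffD2[OF tendsto_dist_iff])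
    then have "Cauchy (\<lambda>n. a n (\<phi> x))"
      by (rule LIMSEQ_imp_Cauchy)
    then show ?thesis
      unfolding g_def using lim by (simp add: limI)
  qed
  ultimately show thesis by (rule that)
qed

abbreviation unit_uniform :: "real measure" where
  "unit_uniform \<equiv> uniform_measure lborel {0..1}"

lemma prob_space_unit_uniform: "prob_space unit_uniform"
  by (rule prob_space_uniform_measure) auto

text \<open>
  Transport \<open>\<mu>\<close> to the line by \<open>\<phi>\<close>, realise the image by its quantile function, and decode by \<open>g\<close>.
\<close>

lemma uniform_realisation:
  fixes \<mu> :: "'a::polish_space measure"
  assumes "prob_space \<mu>" and [simp]: "sets \<mu> = sets borel"
  obtains h where "h \<in> borel_measurable borel" "distr unit_uniform borel h = \<mu>"
proof -
  obtain \<phi> :: "'a \<Rightarrow> real" and g where [measurable]: "\<phi> \<in> borel_measurable borel" "g \<in> borel_measurable borel"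
    and g: "\<And>x. g (\<phi> x) = x"
    by (rule borel_section_of_reals) blast
  interpret prob_space \<mu> by fact
  have \<phi>[measurable]: "\<phi> \<in> borel_measurable \<mu>" by (simp add: measurable_cong_sets[OF assms(2) refl])
  interpret L: cdf_distribution "distr \<mu> borel \<phi>"
    unfolding cdf_distribution_def by (rule real_distribution_distr) simp
  define Q where "Q u = (if u \<in> {0<..<1} then L.I u else 0)" for u
  have Q [measurable]: "Q \<in> borel_measurable borel"
    using L.measurable_CI unfolding Q_def by (subst (asm) measurable_restrict_space_iff[where c=0]) auto
  have "distr unit_uniform borel Q = distr \<mu> borel \<phi>"
  proof (rule measure_eqI)
    fix X :: "real set" assume "X \<in> sets (distr unit_uniform borel Q)"
    then have [measurable]: "X \<in> sets borel" by simp
    have "emeasure (distr unit_uniform borel Q) X = emeasure lborel ({0..1} \<inter> Q -` X)"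
      using measurable_sets[OF Q, of X] by (simp add: emeasure_distr divide_ennreal_def)
    also have "\<dots> = emeasure lborel (L.I -` X \<inter> {0<..<1})"
    proof (rule emeasure_eq_AE)
      show "AE u in lborel. u \<in> {0..1} \<inter> Q -` X \<longleftrightarrow> u \<in> L.I -` X \<inter> {0<..<1}"
        using AE_lborel_singleton[of 0] AE_lborel_singleton[of 1]
        by eventually_elim (auto simp: Q_def)
      show "{0..1} \<inter> Q -` X \<in> sets lborel" using measurable_sets[OF Q, of X] by auto
      show "L.I -` X \<inter> {0<..<1} \<in> sets lborel"
        using measurable_sets[OF L.measurable_CI, of X]
        by (auto simp: space_restrict_space sets_restrict_space_iff)
    qed
    also have "\<dots> = emeasure (distr (restrict_space lborel {0<..<1}) borel L.I) X"
    proof -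
      have "L.I \<in> borel_measurable (restrict_space lborel {0<..<1})"
        using L.measurable_CI by (simp cong: measurable_cong_sets sets_restrict_space_cong)
      then show ?thesis
        by (subst emeasure_distr) (auto simp: emeasure_restrict_space space_restrict_space)
    qed
    finally show "emeasure (distr unit_uniform borel Q) X = emeasure (distr \<mu> borel \<phi>) X"
      by (simp add: L.distr_I_eq_M)
  qed simp
  then have "distr (distr unit_uniform borel Q) borel g = distr (distr \<mu> borel \<phi>) borel g"
    by simp
  then have "distr unit_uniform borel (g \<circ> Q) = distr \<mu> borel (g \<circ> \<phi>)"
    by (simp add: distr_distr)
  also have "\<dots> = \<mu>"
    using g by (simp add: comp_def distr_id2)
  finally show thesis by (intro that[of "g \<circ> Q"]) simp_all
qed

section \<open>Independent uniform variables and Bernoulli thresholds\<close>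

lemma independent_elements_distr:
  assumes "prob_space M" "independent_elements M K X L Y"
  shows "distr M (K \<Otimes>\<^sub>M L) (\<lambda>\<omega>. (X \<omega>, Y \<omega>)) = distr M K X \<Otimes>\<^sub>M distr M L Y"
proof -
  interpret prob_space M by fact
  have X [measurable]: "X \<in> M \<rightarrow>\<^sub>M K" and Y [measurable]: "Y \<in> M \<rightarrow>\<^sub>M L"
    and ind: "indep_set (sets (vimage_algebra (space M) X K)) (sets (vimage_algebra (space M) Y L))"
    using assms(2) by (auto simp: independent_elements_def)
  interpret X: prob_space "distr M K X" by (rule prob_space_distr) fact
  interpret Y: prob_space "distr M L Y" by (rule prob_space_distr) fact
  show ?thesis
  proof (rule pair_measure_eqI[symmetric])
    fix A B assume "A \<in> sets (distr M K X)" "B \<in> sets (distr M L Y)"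
    then have [measurable]: "A \<in> sets K" "B \<in> sets L" by auto
    have "prob ((X -` A \<inter> space M) \<inter> (Y -` B \<inter> space M)) = prob (X -` A \<inter> space M) * prob (Y -` B \<inter> space M)"
      using ind by (rule indep_setD) (auto intro: in_vimage_algebra)
    moreover have "(X -` A \<inter> space M) \<inter> (Y -` B \<inter> space M) = (\<lambda>\<omega>. (X \<omega>, Y \<omega>)) -` (A \<times> B) \<inter> space M"
      by auto
    ultimately show "emeasure (distr M K X) A * emeasure (distr M L Y) B
        = emeasure (distr M (K \<Otimes>\<^sub>M L) (\<lambda>\<omega>. (X \<omega>, Y \<omega>))) (A \<times> B)"
      by (simp add: emeasure_distr emeasure_eq_measure ennreal_mult')
  qed (auto intro: X.sigma_finite_measure_axioms Y.sigma_finite_measure_axioms)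
qed

lemma iid_uniform_rv: "prob_space M \<Longrightarrow> iid_uniform M U I \<Longrightarrow> i \<in> I \<Longrightarrow> U i \<in> borel_measurable M"
  by (simp add: iid_uniform_def prob_space.indep_vars_def)

lemma iid_uniform_reindex:
  assumes "prob_space M" "iid_uniform M U J" "inj_on g I" "g ` I \<subseteq> J"
  shows "iid_uniform M (\<lambda>i. U (g i)) I"
proof -
  interpret prob_space M by fact
  have "indep_vars (\<lambda>_. borel) U J" using assms by (simp add: iid_uniform_def)
  then have "indep_vars (\<lambda>i. PiM {g i} (\<lambda>_. borel)) (\<lambda>i \<omega>. restrict (\<lambda>k. U k \<omega>) {g i}) I"
    using assms by (intro indep_vars_restrict) (auto simp: disjoint_family_on_def inj_on_def)
  then have "indep_vars (\<lambda>_. borel) (\<lambda>i \<omega>. (\<lambda>f. f (g i)) (restrict (\<lambda>k. U k \<omega>) {g i})) I"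
    by (rule indep_vars_compose2) measurable
  then show ?thesis
    using assms by (auto simp: iid_uniform_def)
qed

text \<open>
  Sub-families with disjoint index sets are independent; the selections \<open>f\<close> and \<open>g\<close> may repeat indices,
  as a symmetric array does.
\<close>

lemma iid_uniform_split_independent:
  assumes "prob_space M" "iid_uniform M U J" "A \<inter> B = {}" "A \<subseteq> J" "B \<subseteq> J"
    and "range f \<subseteq> A" "range g \<subseteq> B"
  shows "independent_elements M (PiM UNIV (\<lambda>_. borel)) (\<lambda>\<omega> i. U (f i) \<omega>)
                                (PiM UNIV (\<lambda>_. borel)) (\<lambda>\<omega> i. U (g i) \<omega>)"
proof -
  interpret prob_space M by fact
  let ?A = "PiM A (\<lambda>_. borel :: real measure)" and ?B = "PiM B (\<lambda>_. borel :: real measure)"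
  let ?X = "\<lambda>\<omega>. restrict (\<lambda>k. U k \<omega>) A" and ?Y = "\<lambda>\<omega>. restrict (\<lambda>k. U k \<omega>) B"
  have ind: "indep_var ?A ?X ?B ?Y"
    using assms by (intro indep_var_restrict) (auto simp: iid_uniform_def)
  have [measurable]: "?X \<in> M \<rightarrow>\<^sub>M ?A" "?Y \<in> M \<rightarrow>\<^sub>M ?B"
    using indep_var_rv1[OF ind] indep_var_rv2[OF ind] by auto
  have F [measurable]: "(\<lambda>u i. u (f i)) \<in> ?A \<rightarrow>\<^sub>M PiM UNIV (\<lambda>_. borel :: real measure)"
    using assms(6) by (intro measurable_PiM_single' measurable_component_singleton) (auto simp: space_PiM)
  have G [measurable]: "(\<lambda>u i. u (g i)) \<in> ?B \<rightarrow>\<^sub>M PiM UNIV (\<lambda>_. borel :: real measure)"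
    using assms(7) by (intro measurable_PiM_single' measurable_component_singleton) (auto simp: space_PiM)
  have XF: "(\<lambda>\<omega> i. U (f i) \<omega>) = (\<lambda>\<omega>. (\<lambda>u i. u (f i)) (?X \<omega>))"
    and YG: "(\<lambda>\<omega> i. U (g i) \<omega>) = (\<lambda>\<omega>. (\<lambda>u i. u (g i)) (?Y \<omega>))"
    using assms(6,7) by (auto simp: fun_eq_iff image_subset_iff)
  have rv: "(\<lambda>\<omega> i. U (f i) \<omega>) \<in> M \<rightarrow>\<^sub>M PiM UNIV (\<lambda>_. borel)" "(\<lambda>\<omega> i. U (g i) \<omega>) \<in> M \<rightarrow>\<^sub>M PiM UNIV (\<lambda>_. borel)"
    unfolding XF YG by measurable
  \<comment> \<open>The sigma-algebra of a function of \<open>Z\<close> lies in that of \<open>Z\<close>.\<close>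
  have sub: "sets (vimage_algebra (space M) (\<lambda>\<omega>. h (Z \<omega>)) N) \<subseteq> sigma_sets (space M) {Z -` C \<inter> space M |C. C \<in> sets L}"
    if Z: "Z \<in> M \<rightarrow>\<^sub>M L" and h: "h \<in> L \<rightarrow>\<^sub>M N" for Z L h N
  proof
    fix E assume "E \<in> sets (vimage_algebra (space M) (\<lambda>\<omega>. h (Z \<omega>)) N)"
    moreover have "(\<lambda>\<omega>. h (Z \<omega>)) \<in> space M \<rightarrow> space N"
      using measurable_space[OF measurable_compose[OF Z h]] by auto
    ultimately obtain C where C: "C \<in> sets N" "E = (\<lambda>\<omega>. h (Z \<omega>)) -` C \<inter> space M"
      by (auto simp: sets_vimage_algebra2)
    then have "E = Z -` (h -` C \<inter> space L) \<inter> space M"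
      using measurable_space[OF Z] by auto
    then show "E \<in> sigma_sets (space M) {Z -` C \<inter> space M |C. C \<in> sets L}"
      using C(1) h by (blast intro: measurable_sets)
  qed
  have "indep_set (sigma_sets (space M) {?X -` C \<inter> space M |C. C \<in> sets ?A})
                  (sigma_sets (space M) {?Y -` C \<inter> space M |C. C \<in> sets ?B})"
    using ind unfolding indep_var_eq by blast
  then have "indep_set (sets (vimage_algebra (space M) (\<lambda>\<omega> i. U (f i) \<omega>) (PiM UNIV (\<lambda>_. borel))))
                       (sets (vimage_algebra (space M) (\<lambda>\<omega> i. U (g i) \<omega>) (PiM UNIV (\<lambda>_. borel))))"
    unfolding indep_set_def XF YG
  proof (rule indep_sets_mono_sets)
    fix b :: bool
    show "case_bool (sets (vimage_algebra (space M) (\<lambda>\<omega>. (\<lambda>u i. u (f i)) (?X \<omega>)) (PiM UNIV (\<lambda>_. borel))))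
                    (sets (vimage_algebra (space M) (\<lambda>\<omega>. (\<lambda>u i. u (g i)) (?Y \<omega>)) (PiM UNIV (\<lambda>_. borel)))) b
      \<subseteq> case_bool (sigma_sets (space M) {?X -` C \<inter> space M |C. C \<in> sets ?A})
                    (sigma_sets (space M) {?Y -` C \<inter> space M |C. C \<in> sets ?B}) b"
      using sub[OF \<open>?X \<in> M \<rightarrow>\<^sub>M ?A\<close> F] sub[OF \<open>?Y \<in> M \<rightarrow>\<^sub>M ?B\<close> G]
      by (simp only: split: bool.split) blast
  qed
  with rv show ?thesis by (simp add: independent_elements_def)
qed

text \<open>
  One sequence supplies both arrays: even places go to the vertices, odd places to the unordered pairs.
\<close>

definition vertex_array :: "(nat \<Rightarrow> 'r) \<Rightarrow> nat \<Rightarrow> 'r" where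
  "vertex_array u i = u (2 * i)"

definition edge_array :: "(nat \<Rightarrow> 'r) \<Rightarrow> nat \<times> nat \<Rightarrow> 'r" where
  "edge_array u p = (case p of (i, j) \<Rightarrow> u (Suc (2 * prod_encode (min i j, max i j))))"

lemma uniform_arrays_of_sequence:
  assumes "prob_space M" "iid_uniform M U UNIV"
  shows "uniform_arrays M (vertex_array U) (edge_array U)"
  unfolding uniform_arrays_def
proof (intro conjI allI)
  let ?g = "\<lambda>(i, j). Suc (2 * prod_encode (min i j, max i j))"
  have vertex: "vertex_array U = (\<lambda>i. U (2 * i))" and edge: "edge_array U = (\<lambda>p. U (?g p))"
    by (auto simp: vertex_array_def edge_array_def fun_eq_iff)
  show "iid_uniform M (vertex_array U) UNIV"
    unfolding vertex by (rule iid_uniform_reindex[OF assms]) (auto simp: inj_on_def)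
  have "inj_on ?g {(i, j). i \<le> j}"
    by (auto simp: inj_on_def)
  then show "iid_uniform M (edge_array U) {(i, j). i \<le> j}"
    unfolding edge by (rule iid_uniform_reindex[OF assms]) simp
  show "edge_array U (i, j) = edge_array U (j, i)" for i j
    by (simp add: edge_array_def min.commute max.commute)
  show "independent_elements M (PiM UNIV (\<lambda>_. borel)) (\<lambda>\<omega> i. vertex_array U i \<omega>)
                               (PiM UNIV (\<lambda>_. borel)) (\<lambda>\<omega> p. edge_array U p \<omega>)"
    unfolding vertex edge
    by (rule iid_uniform_split_independent[OF assms, of "{k. even k}" "{k. odd k}"]) auto
qed

lemma iid_uniform_coordinates:
  "iid_uniform (PiM UNIV (\<lambda>_. unit_uniform)) (\<lambda>k u. u k) UNIV"
proof -
  let ?P = "PiM (UNIV :: 'i set) (\<lambda>_. unit_uniform)"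
  interpret prob_space ?P
    by (rule prob_space_PiM) (rule prob_space_unit_uniform)
  have comp: "distr ?P borel (\<lambda>u. u k) = unit_uniform" for k
  proof -
    have "distr ?P unit_uniform (\<lambda>u. u k) = unit_uniform"
      by (rule distr_PiM_component) (simp_all add: prob_space_unit_uniform)
    then show ?thesis by (simp cong: distr_cong)
  qed
  have sets: "sets (PiM UNIV (\<lambda>_::'i. borel :: real measure)) = sets ?P"
    by (rule sets_PiM_cong) auto
  have "indep_vars (\<lambda>_. borel) (\<lambda>k u. u k) UNIV"
  proof (subst indep_vars_iff_distr_eq_PiM')
    show "(\<lambda>u. u i) \<in> ?P \<rightarrow>\<^sub>M borel" for i
      using measurable_component_singleton[of i UNIV "\<lambda>_. unit_uniform"] by simp
    have "distr ?P (PiM UNIV (\<lambda>_. borel)) (\<lambda>x. x) = ?P"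
      using sets by (rule distr_id2)
    then show "distr ?P (PiM UNIV (\<lambda>_. borel)) (\<lambda>x. \<lambda>i\<in>UNIV. x i) = PiM UNIV (\<lambda>i. distr ?P borel (\<lambda>u. u i))"
      by (simp add: comp restrict_UNIV)
  qed simp
  then show ?thesis by (simp add: iid_uniform_def comp)
qed

lemma measure_unit_uniform_le:
  assumes "0 \<le> w" "w \<le> 1"
  shows "measure unit_uniform {v. (v \<le> w) = b} = (if b then w else 1 - w)"
proof -
  have "measure unit_uniform {v. v \<le> w} = w"
  proof -
    have "{0..1} \<inter> {v. v \<le> w} = {0..w}" using assms by auto
    then show ?thesis using assms by simp
  qed
  moreover have "measure unit_uniform {v. \<not> v \<le> w} = 1 - w"
  proof -
    have "{0..1} \<inter> {v. \<not> v \<le> w} = {w<..1}" using assms by auto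
    then show ?thesis using assms by simp
  qed
  ultimately show ?thesis by (cases b) simp_all
qed

text \<open>
  Conditionally on \<open>X\<close>, the events \<open>V p \<le> w p X\<close> are independent with probabilities \<open>w p X\<close>.
  By independence of \<open>X\<close> and \<open>V\<close>, conditioning amounts to integrating over \<open>V\<close> first with \<open>X\<close> held
  fixed.
\<close>

lemma bernoulli_thresholds:
  assumes "prob_space M" "independent_elements M K X (PiM UNIV (\<lambda>_. borel)) (\<lambda>\<omega> p. V p \<omega>)"
    and V: "iid_uniform M V I" and T: "finite T" "T \<subseteq> I"
    and w [measurable]: "\<And>p. w p \<in> borel_measurable K"
    and w01: "\<And>p x. 0 \<le> w p x" "\<And>p x. w p x \<le> 1"
  shows "measure M {\<omega> \<in> space M. \<forall>p\<in>T. (V p \<omega> \<le> w p (X \<omega>)) = b p}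
    = (\<integral>\<omega>. (\<Prod>p\<in>T. if b p then w p (X \<omega>) else 1 - w p (X \<omega>)) \<partial>M)"
proof -
  interpret prob_space M by fact
  let ?L = "PiM UNIV (\<lambda>_. borel :: real measure)"
  let ?q = "\<lambda>x. \<Prod>p\<in>T. if b p then w p x else 1 - w p x"
  have X [measurable]: "X \<in> M \<rightarrow>\<^sub>M K" and Y [measurable]: "(\<lambda>\<omega> p. V p \<omega>) \<in> M \<rightarrow>\<^sub>M ?L"
    using assms(2) by (auto simp: independent_elements_def)
  interpret X: prob_space "distr M K X" by (rule prob_space_distr) fact
  interpret Y: prob_space "distr M ?L (\<lambda>\<omega> p. V p \<omega>)" by (rule prob_space_distr) fact
  \<comment> \<open>The event as a set of pairs; its slices at a fixed value of \<open>X\<close> are intersections of independent events.\<close>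
  define E where "E = {z \<in> space (K \<Otimes>\<^sub>M ?L). \<forall>p\<in>T. (snd z p \<le> w p (fst z)) = b p}"
  have E [measurable]: "E \<in> sets (K \<Otimes>\<^sub>M ?L)"
    unfolding E_def
  proof (rule sets.sets_Collect_finite_All[OF _ T(1)])
    show "{z \<in> space (K \<Otimes>\<^sub>M ?L). (snd z p \<le> w p (fst z)) = b p} \<in> sets (K \<Otimes>\<^sub>M ?L)" for p
    proof -
      have "(\<lambda>z. snd z p) \<in> borel_measurable (K \<Otimes>\<^sub>M ?L)"
        by (rule measurable_compose[OF measurable_snd measurable_component_singleton]) simp
      moreover have "(\<lambda>z. w p (fst z)) \<in> borel_measurable (K \<Otimes>\<^sub>M ?L)"
        by (rule measurable_compose[OF measurable_fst w])
      ultimately have "{z \<in> space (K \<Otimes>\<^sub>M ?L). snd z p \<le> w p (fst z)} \<in> sets (K \<Otimes>\<^sub>M ?L)"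
        by (rule borel_measurable_le)
      then show ?thesis
        using sets.sets_Collect_neg[of "K \<Otimes>\<^sub>M ?L" "\<lambda>z. snd z p \<le> w p (fst z)"]
        by (cases "b p") simp_all
    qed
  qed
  have slice: "emeasure (distr M ?L (\<lambda>\<omega> p. V p \<omega>)) (Pair x -` E) = ennreal (?q x)" if x: "x \<in> space K" for x
  proof -
    have xE: "Pair x -` E \<in> sets ?L" by (rule sets_Pair1) (rule E)
    have "emeasure (distr M ?L (\<lambda>\<omega> p. V p \<omega>)) (Pair x -` E)
        = emeasure M {\<omega> \<in> space M. \<forall>p\<in>T. V p \<omega> \<in> {v. (v \<le> w p x) = b p}}"
      by (subst emeasure_distr[OF Y xE]) (auto simp: E_def x space_pair_measure space_PiM intro!: arg_cong[where f="emeasure M"])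
    also have "\<dots> = ennreal (prob {\<omega> \<in> space M. \<forall>p\<in>T. V p \<omega> \<in> {v. (v \<le> w p x) = b p}})"
      by (rule emeasure_eq_measure)
    also have "prob {\<omega> \<in> space M. \<forall>p\<in>T. V p \<omega> \<in> {v. (v \<le> w p x) = b p}} = ?q x"
    proof (cases "T = {}")
      case True then show ?thesis by (simp add: prob_space)
    next
      case False
      have "{\<omega> \<in> space M. \<forall>p\<in>T. V p \<omega> \<in> {v. (v \<le> w p x) = b p}}
          = (\<Inter>p\<in>T. V p -` {v. (v \<le> w p x) = b p} \<inter> space M)"
        using False by auto
      also have "prob \<dots> = (\<Prod>p\<in>T. prob (V p -` {v. (v \<le> w p x) = b p} \<inter> space M))"
        using V False T by (intro indep_varsD[of "\<lambda>_. borel"]) (auto simp: iid_uniform_def)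
      also have "\<dots> = ?q x"
      proof (rule prod.cong[OF refl])
        fix p assume "p \<in> T"
        with T have "p \<in> I" by auto
        then have [measurable]: "V p \<in> borel_measurable M" and law: "distr M borel (V p) = unit_uniform"
          using V iid_uniform_rv[OF assms(1)] by (auto simp: iid_uniform_def)
        have "prob (V p -` {v. (v \<le> w p x) = b p} \<inter> space M) = measure (distr M borel (V p)) {v. (v \<le> w p x) = b p}"
          by (rule measure_distr[symmetric]) measurable
        then show "prob (V p -` {v. (v \<le> w p x) = b p} \<inter> space M) = (if b p then w p x else 1 - w p x)"
          unfolding law using measure_unit_uniform_le w01 by simp
      qed
      finally show ?thesis .
    qed
    finally show ?thesis .
  qed
  have vimage: "(\<lambda>\<omega>. (X \<omega>, \<lambda>p. V p \<omega>)) -` E \<inter> space M = {\<omega> \<in> space M. \<forall>p\<in>T. (V p \<omega> \<le> w p (X \<omega>)) = b p}"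
  proof (rule set_eqI)
    fix \<omega>
    have "(X \<omega>, \<lambda>p. V p \<omega>) \<in> space (K \<Otimes>\<^sub>M ?L)" if "\<omega> \<in> space M"
      using measurable_space[OF measurable_Pair[OF X Y] that] .
    then show "\<omega> \<in> (\<lambda>\<omega>. (X \<omega>, \<lambda>p. V p \<omega>)) -` E \<inter> space M
        \<longleftrightarrow> \<omega> \<in> {\<omega> \<in> space M. \<forall>p\<in>T. (V p \<omega> \<le> w p (X \<omega>)) = b p}"
      unfolding E_def by (cases "\<omega> \<in> space M") (simp_all only: vimage_eq Int_iff mem_Collect_eq fst_conv snd_conv simp_thms)
  qed
  have "emeasure M {\<omega> \<in> space M. \<forall>p\<in>T. (V p \<omega> \<le> w p (X \<omega>)) = b p}
      = emeasure (distr M (K \<Otimes>\<^sub>M ?L) (\<lambda>\<omega>. (X \<omega>, \<lambda>p. V p \<omega>))) E"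
    unfolding emeasure_distr[OF measurable_Pair[OF X Y] E] vimage ..
  also have "\<dots> = emeasure (distr M K X \<Otimes>\<^sub>M distr M ?L (\<lambda>\<omega> p. V p \<omega>)) E"
    by (simp add: independent_elements_distr[OF assms(1,2)])
  also have "\<dots> = (\<integral>\<^sup>+x. emeasure (distr M ?L (\<lambda>\<omega> p. V p \<omega>)) (Pair x -` E) \<partial>distr M K X)"
    by (rule Y.emeasure_pair_measure_alt) simp
  also have "\<dots> = (\<integral>\<^sup>+x. ennreal (?q x) \<partial>distr M K X)"
    by (rule nn_integral_cong) (simp add: slice)
  also have "\<dots> = (\<integral>\<^sup>+\<omega>. ennreal (?q (X \<omega>)) \<partial>M)"
    by (rule nn_integral_distr) measurable
  finally have "measure M {\<omega> \<in> space M. \<forall>p\<in>T. (V p \<omega> \<le> w p (X \<omega>)) = b p} = enn2real (\<integral>\<^sup>+\<omega>. ennreal (?q (X \<omega>)) \<partial>M)"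
    by (simp add: measure_def)
  also have "\<dots> = (\<integral>\<omega>. ?q (X \<omega>) \<partial>M)"
    using w01 by (intro integral_eq_nn_integral[symmetric] AE_I2 prod_nonneg) auto
  finally show ?thesis .
qed

lemma iid_uniform_distinct:
  assumes "prob_space M" "iid_uniform M U I" "i \<in> I" "j \<in> I" "i \<noteq> j"
  shows "AE \<omega> in M. U i \<omega> \<noteq> U j \<omega>"
proof -
  interpret prob_space M by fact
  interpret P: pair_prob_space unit_uniform unit_uniform
    unfolding pair_prob_space_def pair_sigma_finite_def
    by (simp add: prob_space_unit_uniform prob_space_imp_sigma_finite)
  have [measurable]: "U i \<in> borel_measurable M" "U j \<in> borel_measurable M"
    using assms by (auto intro: iid_uniform_rv)
  have "indep_var (PiM {i} (\<lambda>_. borel)) (\<lambda>\<omega>. restrict (\<lambda>k. U k \<omega>) {i}) (PiM {j} (\<lambda>_. borel)) (\<lambda>\<omega>. restrict (\<lambda>k. U k \<omega>) {j})"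
    using assms by (intro indep_var_restrict) (auto simp: iid_uniform_def)
  then have "indep_var borel ((\<lambda>f. f i) \<circ> (\<lambda>\<omega>. restrict (\<lambda>k. U k \<omega>) {i})) borel ((\<lambda>f. f j) \<circ> (\<lambda>\<omega>. restrict (\<lambda>k. U k \<omega>) {j}))"
    by (rule indep_var_compose) measurable
  then have "indep_var borel (U i) borel (U j)"
    by (simp add: comp_def)
  then have law: "distr M (borel \<Otimes>\<^sub>M borel) (\<lambda>\<omega>. (U i \<omega>, U j \<omega>)) = unit_uniform \<Otimes>\<^sub>M unit_uniform"
    using assms by (simp add: indep_var_distribution_eq iid_uniform_def)
  have "AE z in unit_uniform \<Otimes>\<^sub>M unit_uniform. fst z \<noteq> snd z"
  proof (rule P.AE_pair_measure)
    show "{z \<in> space (unit_uniform \<Otimes>\<^sub>M unit_uniform). fst z \<noteq> snd z} \<in> sets (unit_uniform \<Otimes>\<^sub>M unit_uniform)"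
      by measurable
    show "AE x in unit_uniform. AE y in unit_uniform. fst (x, y) \<noteq> snd (x, y)"
    proof (rule AE_I2)
      fix x :: real
      have "AE y in lborel. y \<noteq> x" by (rule AE_lborel_singleton)
      then show "AE y in unit_uniform. fst (x, y) \<noteq> snd (x, y)"
        by (intro AE_uniform_measureI) (auto elim: eventually_mono)
    qed
  qed
  then have "AE z in distr M (borel \<Otimes>\<^sub>M borel) (\<lambda>\<omega>. (U i \<omega>, U j \<omega>)). fst z \<noteq> snd z"
    by (subst law)
  then show ?thesis
    by (subst (asm) AE_distr_iff) auto
qed

lemma iid_uniform_positive:
  assumes "prob_space M" "iid_uniform M U I" "i \<in> I"
  shows "AE \<omega> in M. 0 < U i \<omega>"
proof -
  have [measurable]: "U i \<in> borel_measurable M" using assms by (rule iid_uniform_rv)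
  have law: "distr M borel (U i) = unit_uniform"
    using assms by (simp add: iid_uniform_def)
  have "AE y in distr M borel (U i). 0 < y"
    unfolding law using AE_lborel_singleton[of "0::real"]
    by (intro AE_uniform_measureI) (auto elim: eventually_mono)
  then show ?thesis
    by (subst (asm) AE_distr_iff) auto
qed

section \<open>Laws of random graphs\<close>

text \<open>
  Every finite set of entries lies in a corner, so the corners determine all cylinder probabilities.
\<close>

lemma matrix_law_eqI:
  assumes "prob_space D" and D: "sets D = sets matrix_space" and D': "sets D' = sets matrix_space"
    and corners: "\<And>n. 1 \<le> n \<Longrightarrow> distr D (corner_space n) (corner n) = distr D' (corner_space n) (corner n)"
  shows "D = D'"
proof (rule measure_eqI_PiM_infinite[OF D D'])
  show "finite_measure D" using assms(1) by (simp add: prob_space_def)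
  fix A :: "nat \<times> nat \<Rightarrow> bool set" and J :: "(nat \<times> nat) set"
  assume J: "finite J"
  have space: "space D = UNIV" "space D' = UNIV"
    using sets_eq_imp_space_eq[OF D] sets_eq_imp_space_eq[OF D'] by (auto simp: space_PiM)
  define n where "n = Suc (Max (insert 0 (fst ` J \<union> snd ` J)))"
  have "fst p < n \<and> snd p < n" if "p \<in> J" for p
    using J that by (auto simp: n_def less_Suc_eq_le intro!: Max_ge)
  then have Jn: "J \<subseteq> {..<n} \<times> {..<n}" by (force simp: mem_Times_iff)
  let ?C = "prod_emb ({..<n} \<times> {..<n}) (\<lambda>_. count_space UNIV) J (Pi\<^sub>E J A)"
  have C: "?C \<in> sets (corner_space n)"
    using J Jn by (intro sets_PiM_I) auto
  have eq: "prod_emb UNIV (\<lambda>_. count_space UNIV) J (Pi\<^sub>E J A) = corner n -` ?C"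
    using Jn by (auto simp: prod_emb_def Int_absorb1)
  have corner: "corner n \<in> E \<rightarrow>\<^sub>M corner_space n" if "sets E = sets matrix_space" for E
    unfolding measurable_cong_sets[OF that refl] by (rule measurable_restrict_subset) simp
  have "emeasure D (corner n -` ?C) = emeasure (distr D (corner_space n) (corner n)) ?C"
    using emeasure_distr[OF corner[OF D] C] by (simp add: space)
  also have "\<dots> = emeasure (distr D' (corner_space n) (corner n)) ?C"
    using corners[of n] by (simp add: n_def)
  also have "\<dots> = emeasure D' (corner n -` ?C)"
    using emeasure_distr[OF corner[OF D'] C] by (simp add: space)
  finally show "emeasure D (prod_emb UNIV (\<lambda>_. count_space UNIV) J (Pi\<^sub>E J A))
      = emeasure D' (prod_emb UNIV (\<lambda>_. count_space UNIV) J (Pi\<^sub>E J A))"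
    unfolding eq .
qed

definition simple_graph_on :: "nat \<Rightarrow> (nat \<times> nat \<Rightarrow> bool) \<Rightarrow> bool" where
  "simple_graph_on n a \<longleftrightarrow> (\<forall>i<n. \<not> a (i, i)) \<and> (\<forall>i<n. \<forall>j<n. a (i, j) = a (j, i))"

abbreviation upper :: "nat \<Rightarrow> (nat \<times> nat) set" where
  "upper n \<equiv> {(i, j). i < j \<and> j < n}"

lemma finite_upper: "finite (upper n)"
  by (rule finite_subset[of _ "{..<n} \<times> {..<n}"]) auto

lemma sets_upper_event:
  assumes "R \<in> M \<rightarrow>\<^sub>M matrix_space"
  shows "{\<omega> \<in> space M. \<forall>p\<in>upper n. R \<omega> p = b p} \<in> sets M"
proof (rule sets.sets_Collect_finite_All[OF _ finite_upper])
  fix p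
  have "(\<lambda>\<omega>. R \<omega> p) \<in> M \<rightarrow>\<^sub>M count_space UNIV"
    using measurable_compose[OF assms measurable_component_singleton[of p]] by simp
  from measurable_sets[OF this, of "{b p}"]
  show "{\<omega> \<in> space M. R \<omega> p = b p} \<in> sets M"
    by (simp add: vimage_def Int_def conj_commute)
qed

lemma simple_graph_upper_cong:
  assumes "simple_graph_on n a" "simple_graph_on n b" "\<forall>p\<in>upper n. a p = b p"
  shows "corner n a = corner n b"
proof
  fix p :: "nat \<times> nat"
  obtain i j where p: "p = (i, j)" by (cases p)
  show "corner n a p = corner n b p"
  proof (cases "i < n \<and> j < n")
    case True
    consider "i < j" | "i = j" | "j < i" by linarith
    then show ?thesis
      using assms True unfolding p simple_graph_on_def by cases auto
  qed (auto simp: p)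
qed

text \<open>
  Values \<open>b\<close> that are not simple graphs have probability \<open>0\<close>; for the others, equality of the corners
  needs to be tested above the diagonal only.
\<close>

lemma corner_atom_probability:
  assumes "prob_space M" and R: "R \<in> M \<rightarrow>\<^sub>M matrix_space"
    and simple: "AE \<omega> in M. simple_graph_on n (R \<omega>)"
    and b: "b \<in> ({..<n} \<times> {..<n}) \<rightarrow>\<^sub>E UNIV"
  shows "emeasure (distr M (corner_space n) (\<lambda>\<omega>. corner n (R \<omega>))) {b}
    = (if simple_graph_on n b then ennreal (measure M {\<omega> \<in> space M. \<forall>p\<in>upper n. R \<omega> p = b p}) else 0)"
proof -
  interpret prob_space M by fact
  let ?E = "{\<omega> \<in> space M. corner n (R \<omega>) = b}"
  have C: "(\<lambda>\<omega>. corner n (R \<omega>)) \<in> M \<rightarrow>\<^sub>M corner_space n"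
    by (rule measurable_compose[OF R]) (rule measurable_restrict_subset, simp)
  have b': "{b} \<in> sets (corner_space n)"
    using b by (subst count_space_PiM_finite) auto
  have E: "?E \<in> sets M"
    using measurable_sets[OF C b'] by (simp add: vimage_def Int_def conj_commute)
  have corner_b: "corner n b = b"
    using b by (auto simp: fun_eq_iff PiE_iff extensional_def)
  have "emeasure (distr M (corner_space n) (\<lambda>\<omega>. corner n (R \<omega>))) {b} = emeasure M ?E"
    by (subst emeasure_distr[OF C b']) (auto intro!: arg_cong[where f="emeasure M"])
  also have "\<dots> = (if simple_graph_on n b then ennreal (measure M {\<omega> \<in> space M. \<forall>p\<in>upper n. R \<omega> p = b p}) else 0)"
  proof (cases "simple_graph_on n b")
    case True
    have "emeasure M ?E = emeasure M {\<omega> \<in> space M. \<forall>p\<in>upper n. R \<omega> p = b p}"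
    proof (rule emeasure_eq_AE[OF _ E sets_upper_event[OF R]])
      show "AE \<omega> in M. \<omega> \<in> ?E \<longleftrightarrow> \<omega> \<in> {\<omega> \<in> space M. \<forall>p\<in>upper n. R \<omega> p = b p}"
        using simple
      proof eventually_elim
        case (elim \<omega>)
        have "corner n (R \<omega>) = b" if "\<forall>p\<in>upper n. R \<omega> p = b p"
          using simple_graph_upper_cong[OF elim True that] corner_b by simp
        moreover have "R \<omega> p = b p" if "corner n (R \<omega>) = b" "p \<in> upper n" for p
          using that by auto
        ultimately show ?case by blast
      qed
    qed
    then show ?thesis using True by (simp add: emeasure_eq_measure)
  next
    case False
    have "emeasure M ?E = emeasure M {}"
    proof (rule emeasure_eq_AE[OF _ E])
      show "AE \<omega> in M. \<omega> \<in> ?E \<longleftrightarrow> \<omega> \<in> {}"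
        using simple
      proof eventually_elim
        case (elim \<omega>)
        then have "simple_graph_on n (corner n (R \<omega>))"
          by (simp add: simple_graph_on_def)
        then show ?case using False by auto
      qed
    qed simp
    then show ?thesis using False by simp
  qed
  finally show ?thesis .
qed

text \<open>
  A symmetric matrix without loops is determined by its entries above the diagonal, and a corner takes only
  finitely many values.
\<close>

lemma corner_law_eqI:
  assumes "prob_space M" "R \<in> M \<rightarrow>\<^sub>M matrix_space" "AE \<omega> in M. simple_graph_on n (R \<omega>)"
    and "prob_space M'" "R' \<in> M' \<rightarrow>\<^sub>M matrix_space" "AE \<omega> in M'. simple_graph_on n (R' \<omega>)"
    and upper: "\<And>b. measure M {\<omega> \<in> space M. \<forall>p\<in>upper n. R \<omega> p = b p}
        = measure M' {\<omega> \<in> space M'. \<forall>p\<in>upper n. R' \<omega> p = b p}"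
  shows "distr M (corner_space n) (\<lambda>\<omega>. corner n (R \<omega>)) = distr M' (corner_space n) (\<lambda>\<omega>. corner n (R' \<omega>))"
proof (rule measure_eqI_finite)
  let ?X = "({..<n} \<times> {..<n}) \<rightarrow>\<^sub>E (UNIV :: bool set)"
  have "sets (corner_space n) = Pow ?X"
    by (subst count_space_PiM_finite) auto
  then show "sets (distr M (corner_space n) (\<lambda>\<omega>. corner n (R \<omega>))) = Pow ?X"
    "sets (distr M' (corner_space n) (\<lambda>\<omega>. corner n (R' \<omega>))) = Pow ?X" by simp_all
  show "finite ?X" by (intro finite_PiE) auto
  fix b assume b: "b \<in> ?X"
  show "emeasure (distr M (corner_space n) (\<lambda>\<omega>. corner n (R \<omega>))) {b}
      = emeasure (distr M' (corner_space n) (\<lambda>\<omega>. corner n (R' \<omega>))) {b}"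
    using corner_atom_probability[OF assms(1-3) b] corner_atom_probability[OF assms(4-6) b] upper[of b]
    by simp
qed

text \<open>
  The conditional probability, given the points \<open>s\<close>, that the graph has the entries \<open>b\<close> above the diagonal
  of its \<open>n \<times> n\<close> corner.
\<close>

definition kernel_likelihood :: "('a \<times> 'a \<Rightarrow> real) \<Rightarrow> nat \<Rightarrow> (nat \<times> nat \<Rightarrow> bool) \<Rightarrow> (nat \<Rightarrow> 'a) \<Rightarrow> real" where
  "kernel_likelihood W n b s = (\<Prod>(i, j)\<in>upper n. if b (i, j) then W (s i, s j) else 1 - W (s i, s j))"

lemma kernel_likelihood_measurable [measurable]:
  assumes "connection_kernel W"
  shows "kernel_likelihood W n b \<in> borel_measurable (PiM UNIV (\<lambda>_. borel))"
proof -
  have [measurable]: "W \<in> borel_measurable (borel \<Otimes>\<^sub>M borel)"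
    using assms by (simp add: connection_kernel_def)
  have [measurable]: "(\<lambda>s. W (s i, s j)) \<in> borel_measurable (PiM UNIV (\<lambda>_. borel))" for i j :: nat
    by measurable
  show ?thesis
    unfolding kernel_likelihood_def split_beta by measurable
qed

lemma kernel_likelihood_bounds:
  assumes "connection_kernel W"
  shows "0 \<le> kernel_likelihood W n b s" "kernel_likelihood W n b s \<le> 1"
  using assms unfolding kernel_likelihood_def connection_kernel_def
  by (auto intro!: prod_nonneg prod_le_1)

lemma iid_sequence_distr:
  fixes X :: "nat \<Rightarrow> 'w \<Rightarrow> 'b::topological_space"
  assumes "prob_space M" "prob_space.indep_vars M (\<lambda>_. borel) X UNIV" "\<And>k. distr M borel (X k) = \<mu>"
  shows "distr M (PiM UNIV (\<lambda>_. borel)) (\<lambda>\<omega> k. X k \<omega>) = PiM UNIV (\<lambda>_. \<mu>)"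
proof -
  interpret prob_space M by fact
  have "distr M (PiM UNIV (\<lambda>_. borel)) (\<lambda>\<omega>. \<lambda>k\<in>UNIV. X k \<omega>) = PiM UNIV (\<lambda>k. distr M borel (X k))"
    using assms(2) by (subst indep_vars_iff_distr_eq_PiM'[symmetric]) (auto simp: indep_vars_def)
  then show ?thesis by (simp add: assms(3) restrict_UNIV)
qed

section \<open>Sampling from the graphon\<close>

text \<open>
  The diagonal is set to \<open>0\<close> so that the thresholded array has no loops.
\<close>

definition pullback_graphon :: "('a \<times> 'a \<Rightarrow> real) \<Rightarrow> (real \<Rightarrow> 'a) \<Rightarrow> real \<times> real \<Rightarrow> real" where
  "pullback_graphon W h = (\<lambda>(x, y). if x = y then 0 else W (h x, h y))"

lemma pullback_graphon_kernel:
  assumes "connection_kernel W" and [measurable]: "h \<in> borel_measurable borel"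
  shows "connection_kernel (pullback_graphon W h)"
proof -
  have [measurable]: "W \<in> borel_measurable (borel \<Otimes>\<^sub>M borel)"
    using assms by (simp add: connection_kernel_def)
  have "pullback_graphon W h \<in> borel_measurable (borel \<Otimes>\<^sub>M borel)"
    unfolding pullback_graphon_def split_beta by measurable
  then show ?thesis
    using assms(1) by (auto simp: connection_kernel_def pullback_graphon_def)
qed

lemma connection_kernel_graphon: "connection_kernel w \<Longrightarrow> graphon w"
  unfolding connection_kernel_def graphon_def
  by (auto intro: measurable_restrict_space1)

definition threshold_matrix :: "(real \<times> real \<Rightarrow> real) \<Rightarrow> (nat \<Rightarrow> real) \<Rightarrow> nat \<times> nat \<Rightarrow> bool" where
  "threshold_matrix w u p \<longleftrightarrow> edge_array u p \<le> w (vertex_array u (fst p), vertex_array u (snd p))"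

lemma measurable_threshold_matrix:
  assumes "connection_kernel w"
  shows "threshold_matrix w \<in> PiM UNIV (\<lambda>_. borel) \<rightarrow>\<^sub>M matrix_space"
proof (rule measurable_PiM_single')
  let ?L = "PiM (UNIV :: nat set) (\<lambda>_. borel :: real measure)"
  fix p :: "nat \<times> nat"
  have [measurable]: "w \<in> borel_measurable (borel \<Otimes>\<^sub>M borel)"
    using assms by (simp add: connection_kernel_def)
  have "(\<lambda>u. edge_array u p) \<in> borel_measurable ?L"
    unfolding edge_array_def split_beta by (rule measurable_component_singleton) simp
  moreover have "(\<lambda>u. w (vertex_array u (fst p), vertex_array u (snd p))) \<in> borel_measurable ?L"
    unfolding vertex_array_def by measurable
  ultimately have "{u \<in> space ?L. edge_array u p \<le> w (vertex_array u (fst p), vertex_array u (snd p))} \<in> sets ?L"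
    by (rule borel_measurable_le)
  then show "(\<lambda>u. threshold_matrix w u p) \<in> ?L \<rightarrow>\<^sub>M count_space UNIV"
    unfolding threshold_matrix_def pred_def .
qed auto

lemma threshold_matrix_simple:
  assumes "connection_kernel W" and [measurable]: "h \<in> borel_measurable borel"
  shows "AE u in PiM UNIV (\<lambda>_. unit_uniform). simple_graph_on n (threshold_matrix (pullback_graphon W h) u)"
proof -
  let ?P = "PiM (UNIV :: nat set) (\<lambda>_. unit_uniform)"
  interpret prob_space ?P by (rule prob_space_PiM) (rule prob_space_unit_uniform)
  have "AE u in ?P. 0 < u k" for k
    by (rule iid_uniform_positive[OF prob_space_axioms iid_uniform_coordinates]) simp
  then have "AE u in ?P. \<forall>k. 0 < u k"
    unfolding AE_all_countable by blast
  then show ?thesis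
  proof eventually_elim
    case (elim u)
    have "threshold_matrix (pullback_graphon W h) u (i, j) = threshold_matrix (pullback_graphon W h) u (j, i)" for i j
      using assms(1)
      by (simp add: threshold_matrix_def pullback_graphon_def edge_array_def connection_kernel_def
          min.commute max.commute)
    then show ?case
      using elim unfolding simple_graph_on_def
      by (simp add: threshold_matrix_def pullback_graphon_def edge_array_def not_le)
  qed
qed

text \<open>
  The diagonal convention of \<open>pullback_graphon\<close> disappears because the vertex variables are almost surely
  distinct, and \<open>h\<close> turns them into an i.i.d. sequence.
\<close>

lemma threshold_matrix_upper_probability:
  assumes W: "connection_kernel W" and h [measurable]: "h \<in> borel_measurable borel"
  defines "P \<equiv> PiM UNIV (\<lambda>_. unit_uniform)"
  shows "measure P {u \<in> space P. \<forall>p\<in>upper n. threshold_matrix (pullback_graphon W h) u p = b p}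
    = (\<integral>s. kernel_likelihood W n b s \<partial>PiM UNIV (\<lambda>_. distr unit_uniform borel h))"
proof -
  let ?w = "pullback_graphon W h" and ?L = "PiM (UNIV :: nat set) (\<lambda>_. borel :: real measure)"
  interpret prob_space P unfolding P_def by (rule prob_space_PiM) (rule prob_space_unit_uniform)
  have iid: "iid_uniform P (\<lambda>k u. u k) UNIV"
    unfolding P_def by (rule iid_uniform_coordinates)
  have w: "connection_kernel ?w" by (rule pullback_graphon_kernel[OF W h])
  define U :: "nat \<Rightarrow> (nat \<Rightarrow> real) \<Rightarrow> real" where "U i u = vertex_array u i" for i u
  define V :: "nat \<times> nat \<Rightarrow> (nat \<Rightarrow> real) \<Rightarrow> real" where "V p u = edge_array u p" for p u
  have UV: "uniform_arrays P U V"
  proof -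
    have "U = vertex_array (\<lambda>k u. u k)" "V = edge_array (\<lambda>k u. u k)"
      by (auto simp: fun_eq_iff U_def V_def vertex_array_def edge_array_def)
    then show ?thesis using uniform_arrays_of_sequence[OF prob_space_axioms iid] by simp
  qed
  then have U: "iid_uniform P U UNIV" and V: "iid_uniform P V {(i, j). i \<le> j}"
    and ind: "independent_elements P ?L (\<lambda>u i. U i u) (PiM UNIV (\<lambda>_. borel)) (\<lambda>u p. V p u)"
    by (auto simp: uniform_arrays_def)
  have U_rv [measurable]: "U i \<in> borel_measurable P" for i
    using iid_uniform_rv[OF prob_space_axioms U] by simp
  have hU: "(\<lambda>u i. h (U i u)) \<in> P \<rightarrow>\<^sub>M PiM UNIV (\<lambda>_. borel)"
    by (rule measurable_PiM_single') simp_all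
  define v where "v p x = ?w (x (fst p), x (snd p))" for p :: "nat \<times> nat" and x :: "nat \<Rightarrow> real"
  have law: "distr P (PiM UNIV (\<lambda>_. borel)) (\<lambda>u i. h (U i u)) = PiM UNIV (\<lambda>_. distr unit_uniform borel h)"
  proof (rule iid_sequence_distr[where X = "\<lambda>i u. h (U i u)", OF prob_space_axioms])
    show "indep_vars (\<lambda>_. borel) (\<lambda>i u. h (U i u)) UNIV"
      by (rule indep_vars_compose2[where M' = "\<lambda>_. borel" and X = U and Y = "\<lambda>_. h"])
        (use U in \<open>auto simp: iid_uniform_def\<close>)
    show "distr P borel (\<lambda>u. h (U k u)) = distr unit_uniform borel h" for k
    proof -
      have "distr P borel (U k) = unit_uniform" using U by (simp add: iid_uniform_def)
      then have "distr (distr P borel (U k)) borel h = distr unit_uniform borel h" by simp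
      then show ?thesis by (simp add: distr_distr comp_def)
    qed
  qed
  have "measure P {u \<in> space P. \<forall>p\<in>upper n. threshold_matrix ?w u p = b p}
      = measure P {u \<in> space P. \<forall>p\<in>upper n. (V p u \<le> v p (\<lambda>i. U i u)) = b p}"
    by (simp add: threshold_matrix_def v_def U_def V_def)
  also have "\<dots> = (\<integral>u. (\<Prod>p\<in>upper n. if b p then v p (\<lambda>i. U i u) else 1 - v p (\<lambda>i. U i u)) \<partial>P)"
  proof (rule bernoulli_thresholds[where w = v and b = b, OF prob_space_axioms ind V finite_upper])
    have [measurable]: "?w \<in> borel_measurable (borel \<Otimes>\<^sub>M borel)"
      using w by (simp add: connection_kernel_def)
    show "v p \<in> borel_measurable ?L" for p
      unfolding v_def by measurable
    show "0 \<le> v p x" "v p x \<le> 1" for p x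
      using w by (auto simp: v_def connection_kernel_def)
  qed auto
  also have "\<dots> = (\<integral>u. kernel_likelihood W n b (\<lambda>i. h (U i u)) \<partial>P)"
  proof (rule integral_cong_AE)
    have "AE u in P. \<forall>i j. i \<noteq> j \<longrightarrow> U i u \<noteq> U j u"
    proof (unfold AE_all_countable, intro allI)
      show "AE u in P. i \<noteq> j \<longrightarrow> U i u \<noteq> U j u" for i j
        using iid_uniform_distinct[OF prob_space_axioms U, of i j] by (cases "i = j") simp_all
    qed
    then show "AE u in P. (\<Prod>p\<in>upper n. if b p then v p (\<lambda>i. U i u) else 1 - v p (\<lambda>i. U i u))
        = kernel_likelihood W n b (\<lambda>i. h (U i u))"
    proof eventually_elim
      case (elim u)
      then show ?case
        unfolding kernel_likelihood_def
        by (intro prod.cong refl) (auto simp: v_def pullback_graphon_def)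
    qed
    have [measurable]: "?w \<in> borel_measurable (borel \<Otimes>\<^sub>M borel)"
      using w by (simp add: connection_kernel_def)
    show "(\<lambda>u. \<Prod>p\<in>upper n. if b p then v p (\<lambda>i. U i u) else 1 - v p (\<lambda>i. U i u)) \<in> borel_measurable P"
      unfolding v_def by measurable
    show "(\<lambda>u. kernel_likelihood W n b (\<lambda>i. h (U i u))) \<in> borel_measurable P"
      by (rule measurable_compose[OF hU kernel_likelihood_measurable[OF W]])
  qed
  also have "\<dots> = (\<integral>s. kernel_likelihood W n b s \<partial>distr P (PiM UNIV (\<lambda>_. borel)) (\<lambda>u i. h (U i u)))"
    by (rule integral_distr[OF hU kernel_likelihood_measurable[OF W], symmetric])
  also have "\<dots> = (\<integral>s. kernel_likelihood W n b s \<partial>PiM UNIV (\<lambda>_. distr unit_uniform borel h))"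
    by (simp only: law)
  finally show ?thesis .
qed

section \<open>Laws of associated matrices\<close>

lemma independent_elements_integral_mult:
  fixes f :: "'b \<Rightarrow> real" and g :: "'c \<Rightarrow> real"
  assumes "prob_space M" "independent_elements M K X L Y"
    and f [measurable]: "f \<in> borel_measurable K" and g [measurable]: "g \<in> borel_measurable L"
    and bounds: "\<And>x. \<bar>f x\<bar> \<le> 1" "\<And>y. \<bar>g y\<bar> \<le> 1"
  shows "(\<integral>\<omega>. f (X \<omega>) * g (Y \<omega>) \<partial>M) = (\<integral>\<omega>. f (X \<omega>) \<partial>M) * (\<integral>\<omega>. g (Y \<omega>) \<partial>M)"
proof -
  interpret prob_space M by fact
  have X [measurable]: "X \<in> M \<rightarrow>\<^sub>M K" and Y [measurable]: "Y \<in> M \<rightarrow>\<^sub>M L"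
    using assms(2) by (auto simp: independent_elements_def)
  let ?P = "distr M K X" and ?Q = "distr M L Y"
  interpret X: prob_space ?P by (rule prob_space_distr) fact
  interpret Y: prob_space ?Q by (rule prob_space_distr) fact
  interpret XY: pair_prob_space ?P ?Q ..
  have fg: "(\<lambda>z. f (fst z) * g (snd z)) \<in> borel_measurable (K \<Otimes>\<^sub>M L)"
    by measurable
  have "integrable (?P \<Otimes>\<^sub>M ?Q) (\<lambda>z. f (fst z) * g (snd z))"
  proof (rule XY.integrable_const_bound[of _ 1])
    show "(\<lambda>z. f (fst z) * g (snd z)) \<in> borel_measurable (?P \<Otimes>\<^sub>M ?Q)"
      by measurable
    show "AE z in ?P \<Otimes>\<^sub>M ?Q. norm (f (fst z) * g (snd z)) \<le> 1"
      using bounds by (intro AE_I2) (simp add: abs_mult mult_le_one)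
  qed
  then have "(\<integral>x. \<integral>y. f x * g y \<partial>?Q \<partial>?P) = (\<integral>z. f (fst z) * g (snd z) \<partial>(?P \<Otimes>\<^sub>M ?Q))"
    using XY.integral_fst'[of "\<lambda>z. f (fst z) * g (snd z)"] by simp
  also have "\<dots> = (\<integral>\<omega>. f (X \<omega>) * g (Y \<omega>) \<partial>M)"
    unfolding independent_elements_distr[OF assms(1,2), symmetric]
    by (subst integral_distr[OF measurable_Pair[OF X Y] fg]) simp
  finally show ?thesis
    by (simp add: integral_distr[OF X f] integral_distr[OF Y g])
qed

text \<open>
  The event \<open>N = n\<close> belongs to the sigma-algebra generated by \<open>(N, S)\<close>, so integrating the conditional
  probability over it gives the joint probability; since \<open>N\<close> and \<open>S\<close> are independent, this factorises and
  the probability of \<open>N = n\<close> cancels.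
\<close>

lemma iid_representation_upper_probability:
  fixes W :: "'a::polish_space \<times> 'a \<Rightarrow> real"
  assumes "prob_space M" and W: "connection_kernel W" and rep: "iid_representation M W \<xi> N S A"
  defines "E n \<equiv> {\<omega> \<in> space M. N \<omega> = enat n}"
  assumes pos: "measure M (E n) \<noteq> 0"
  shows "measure (uniform_measure M (E n)) {\<omega> \<in> space M. \<forall>p\<in>upper n. A \<omega> p = b p}
    = (\<integral>s. kernel_likelihood W n b s \<partial>PiM UNIV (\<lambda>_. distr M borel (\<lambda>\<omega>. S \<omega> 0)))"
proof -
  interpret prob_space M by fact
  let ?L = "PiM (UNIV :: nat set) (\<lambda>_. borel :: 'a measure)"
  let ?NS = "\<lambda>\<omega>. (N \<omega>, S \<omega>)" and ?K = "count_space UNIV \<Otimes>\<^sub>M ?L"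
  let ?F = "vimage_algebra (space M) ?NS ?K"
  define G where "G = {\<omega> \<in> space M. \<forall>p\<in>upper n. A \<omega> p = b p}"
  let ?q = "kernel_likelihood W n b"
  have N [measurable]: "N \<in> M \<rightarrow>\<^sub>M count_space UNIV" and S [measurable]: "S \<in> M \<rightarrow>\<^sub>M ?L"
    and A: "A \<in> M \<rightarrow>\<^sub>M matrix_space" and ind: "independent_elements M (count_space UNIV) N ?L S"
    and indS: "indep_vars (\<lambda>_. borel) (\<lambda>k \<omega>. S \<omega> k) UNIV"
    and lawS: "\<And>k. distr M borel (\<lambda>\<omega>. S \<omega> k) = distr M borel (\<lambda>\<omega>. S \<omega> 0)"
    using rep by (auto simp: iid_representation_def graph_representation_def adjacency_representation_def)
  have q [measurable]: "?q \<in> borel_measurable ?L"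
    by (rule kernel_likelihood_measurable[OF W])
  have E [measurable]: "E n \<in> sets M" unfolding E_def by measurable
  have G [measurable]: "G \<in> sets M" unfolding G_def by (rule sets_upper_event[OF A])
  have NS: "?NS \<in> M \<rightarrow>\<^sub>M ?K" by measurable
  have sub: "subalgebra M ?F"
    unfolding subalgebra_def using sets_vimage_algebra2[of ?NS "space M" ?K] measurable_space[OF NS]
    by (auto intro: measurable_sets[OF NS])
  interpret F: finite_measure_subalgebra M ?F
    by unfold_locales (rule sub)
  have EF: "E n \<in> sets ?F"
  proof -
    have "{enat n} \<times> space ?L \<in> sets ?K" by simp
    moreover have "E n = ?NS -` ({enat n} \<times> space ?L) \<inter> space M"
      using measurable_space[OF S] by (auto simp: E_def)
    ultimately show ?thesis by (simp add: in_vimage_algebra)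
  qed
  have cond: "AE \<omega> in M. \<omega> \<in> E n \<longrightarrow> real_cond_exp M ?F (indicator G) \<omega> = ?q (S \<omega>)"
  proof -
    have graph: "graph_representation M W \<xi> N S A"
      using rep by (simp add: iid_representation_def)
    have "{\<omega> \<in> space M. \<forall>i j. i < j \<and> j < n \<longrightarrow> A \<omega> (i, j) = b (i, j)} = G"
      unfolding G_def by auto
    then have "AE \<omega> in M. enat n \<le> N \<omega> \<longrightarrow> real_cond_exp M ?F (indicator G) \<omega> = ?q (S \<omega>)"
      using graph[unfolded graph_representation_def, THEN conjunct2, THEN conjunct2, THEN spec[of _ n], THEN spec[of _ b]]
      unfolding kernel_likelihood_def by (simp only:)
    then show ?thesis by (auto simp: E_def elim: eventually_mono)
  qed
  have "measure M (E n \<inter> G) = (\<integral>\<omega>\<in>E n. indicator G \<omega> \<partial>M)"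
  proof -
    have "(\<integral>\<omega>\<in>E n. indicator G \<omega> \<partial>M) = (\<integral>\<omega>. indicator (E n \<inter> G) \<omega> \<partial>M :: real)"
      unfolding set_lebesgue_integral_def
      by (rule Bochner_Integration.integral_cong[OF refl]) (simp add: indicator_def)
    then show ?thesis using sets.sets_into_space[OF E] by (simp add: Int_absorb2 le_infI1)
  qed
  also have "\<dots> = (\<integral>\<omega>\<in>E n. real_cond_exp M ?F (indicator G) \<omega> \<partial>M)"
    by (rule F.real_cond_exp_intA[where f = "indicator G", OF _ EF])
      (rule integrable_real_indicator[OF G], simp add: emeasure_eq_measure)
  also have "\<dots> = (\<integral>\<omega>\<in>E n. ?q (S \<omega>) \<partial>M)"
    by (rule set_lebesgue_integral_cong_AE[OF E borel_measurable_cond_exp2 measurable_compose[OF S q] cond])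
  also have "\<dots> = (\<integral>\<omega>. indicator {enat n} (N \<omega>) * ?q (S \<omega>) \<partial>M)"
    unfolding set_lebesgue_integral_def
    by (rule Bochner_Integration.integral_cong) (auto simp: E_def indicator_def)
  also have "\<dots> = (\<integral>\<omega>. indicator {enat n} (N \<omega>) \<partial>M) * (\<integral>\<omega>. ?q (S \<omega>) \<partial>M)"
    by (rule independent_elements_integral_mult[where X = N and Y = S, OF prob_space_axioms ind _ q])
      (auto simp: indicator_def kernel_likelihood_bounds[OF W])
  also have "\<dots> = measure M (E n) * (\<integral>s. ?q s \<partial>PiM UNIV (\<lambda>_. distr M borel (\<lambda>\<omega>. S \<omega> 0)))"
  proof -
    have "(\<integral>\<omega>. indicator {enat n} (N \<omega>) \<partial>M) = (\<integral>\<omega>. indicator (E n) \<omega> \<partial>M :: real)"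
      by (rule Bochner_Integration.integral_cong) (auto simp: E_def indicator_def)
    moreover have "(\<integral>\<omega>. ?q (S \<omega>) \<partial>M) = (\<integral>s. ?q s \<partial>distr M ?L S)"
      by (rule integral_distr[OF S q, symmetric])
    moreover have "distr M ?L S = PiM UNIV (\<lambda>_. distr M borel (\<lambda>\<omega>. S \<omega> 0))"
      using iid_sequence_distr[where X = "\<lambda>k \<omega>. S \<omega> k", OF prob_space_axioms indS lawS] by simp
    ultimately show ?thesis by simp
  qed
  finally have joint: "measure M (E n \<inter> G)
      = measure M (E n) * (\<integral>s. ?q s \<partial>PiM UNIV (\<lambda>_. distr M borel (\<lambda>\<omega>. S \<omega> 0)))" .
  have "measure (uniform_measure M (E n)) G = measure M (E n \<inter> G) / measure M (E n)"
    using pos by (intro measure_uniform_measure) (auto simp: emeasure_eq_measure)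
  with joint pos show ?thesis by (simp add: G_def)
qed

lemma iid_representation_simple:
  assumes "prob_space M" "iid_representation M W \<xi> N S A"
  shows "AE \<omega> in uniform_measure M {\<omega> \<in> space M. N \<omega> = enat n}. simple_graph_on n (A \<omega>)"
proof (rule AE_uniform_measureI)
  have rep: "N \<in> M \<rightarrow>\<^sub>M count_space UNIV"
    "AE \<omega> in M. \<forall>i. enat i < N \<omega> \<longrightarrow> \<not> A \<omega> (i, i)"
    "AE \<omega> in M. \<forall>i j. enat i < N \<omega> \<and> enat j < N \<omega> \<longrightarrow> A \<omega> (i, j) = A \<omega> (j, i)"
    using assms(2) by (auto simp: iid_representation_def graph_representation_def adjacency_representation_def)
  then show "{\<omega> \<in> space M. N \<omega> = enat n} \<in> sets M"
    using measurable_sets[OF rep(1), of "{enat n}"] by (simp add: vimage_def Int_def conj_commute)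
  show "AE \<omega> in M. \<omega> \<in> {\<omega> \<in> space M. N \<omega> = enat n} \<longrightarrow> simple_graph_on n (A \<omega>)"
    using rep(2,3) by eventually_elim (simp add: simple_graph_on_def)
qed

text \<open>
  Conditioning on a null event yields the null measure, whereas the right-hand side of the matching condition
  has total mass \<open>1\<close>.
\<close>

lemma matches_representations_positive:
  assumes "prob_space M" "iid_representation M W (\<lambda>\<omega>. restrict_adjacency (\<xi> \<omega>) B) N S A"
    and "matches_representations M W \<xi> B D" "1 \<le> n"
  shows "measure M {\<omega> \<in> space M. N \<omega> = enat n} \<noteq> 0"
proof
  interpret prob_space M by fact
  let ?E = "{\<omega> \<in> space M. N \<omega> = enat n}"
  assume "measure M ?E = 0"
  then have zero: "emeasure M ?E = 0" by (simp add: emeasure_eq_measure)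
  have N: "N \<in> M \<rightarrow>\<^sub>M count_space UNIV" and A: "A \<in> M \<rightarrow>\<^sub>M matrix_space"
    using assms(2) by (auto simp: iid_representation_def graph_representation_def adjacency_representation_def)
  have E: "?E \<in> sets M"
    using measurable_sets[OF N, of "{enat n}"] by (simp add: vimage_def Int_def conj_commute)
  have D: "prob_space D" "sets D = sets matrix_space"
    using assms(3) by (auto simp: matches_representations_def jointly_exchangeable_law_def)
  have corner: "corner n \<in> matrix_space \<rightarrow>\<^sub>M corner_space n"
    by (rule measurable_restrict_subset) simp
  let ?Q = "distr (uniform_measure M ?E) (corner_space n) (\<lambda>\<omega>. corner n (A \<omega>))"
  have eq: "?Q = distr D (corner_space n) (corner n)"
    using assms(2-4) unfolding matches_representations_def by blast
  have "prob_space (distr D (corner_space n) (corner n))"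
    using D corner by (intro prob_space.prob_space_distr) (simp_all cong: measurable_cong_sets)
  then have "emeasure ?Q (space (corner_space n)) = 1"
    unfolding eq using prob_space.emeasure_space_1 by fastforce
  moreover have "emeasure ?Q (space (corner_space n)) = emeasure (uniform_measure M ?E) (space M)"
    using measurable_compose[OF A corner]
    by (subst emeasure_distr)
      (auto simp: space_PiM intro!: arg_cong[where f="emeasure _"])
  moreover have "emeasure (uniform_measure M ?E) (space M) = 0"
    using E zero by (subst emeasure_uniform_measure) (auto simp: Int_absorb2)
  ultimately show False by simp
qed

lemma jointly_exchangeable_constant: "jointly_exchangeable_law (return matrix_space (\<lambda>_. c))"
  unfolding jointly_exchangeable_law_def
proof (intro conjI allI impI)
  show "prob_space (return matrix_space (\<lambda>_. c))"
    by (rule prob_space_return) (simp add: space_PiM)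
  fix \<pi> :: "nat \<Rightarrow> nat"
  have "(\<lambda>a (i, j). a (\<pi> i, \<pi> j)) \<in> matrix_space \<rightarrow>\<^sub>M matrix_space"
    unfolding split_beta by (rule measurable_PiM_single') (simp_all add: measurable_component_singleton)
  then have "distr (return matrix_space (\<lambda>_. c)) matrix_space (\<lambda>a (i, j). a (\<pi> i, \<pi> j))
      = return matrix_space ((\<lambda>a (i, j). a (\<pi> i, \<pi> j)) (\<lambda>_. c))"
    by (rule distr_return) (simp add: space_PiM)
  then show "distr (return matrix_space (\<lambda>_. c)) matrix_space (\<lambda>a (i, j). a (\<pi> i, \<pi> j)) = return matrix_space (\<lambda>_. c)"
    by (simp add: case_prod_unfold)
qed simp

text \<open>
  Without any representation the matching condition is vacuous, and then both the complete and the empty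
  array would be matching laws.
\<close>

lemma unique_match_imp_representation:
  assumes "\<exists>!D. matches_representations M W \<xi> B D"
  obtains N S A where "iid_representation M W (\<lambda>\<omega>. restrict_adjacency (\<xi> \<omega>) B) N S A"
proof (rule ccontr)
  assume "\<not> thesis"
  then have none: "\<not> iid_representation M W (\<lambda>\<omega>. restrict_adjacency (\<xi> \<omega>) B) N S A" for N S A
    using that by blast
  have "matches_representations M W \<xi> B (return matrix_space (\<lambda>_. c))" for c
    unfolding matches_representations_def using none jointly_exchangeable_constant by blast
  then have eq: "return matrix_space (\<lambda>_. True) = return matrix_space (\<lambda>_. False)"
    using assms by blast
  \<comment> \<open>The two constant arrays differ in any entry.\<close>
  let ?X = "{a \<in> space matrix_space. a (0, 0)}"
  have X: "?X \<in> sets matrix_space" by measurable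
  have "emeasure (return matrix_space (\<lambda>_. True)) ?X = emeasure (return matrix_space (\<lambda>_. False)) ?X"
    unfolding eq ..
  then show False
    using X by (simp add: emeasure_return space_PiM)
qed

lemma associated_law_eq_threshold_law:
  assumes "prob_space M" and W: "connection_kernel W"
    and rep: "iid_representation M W (\<lambda>\<omega>. restrict_adjacency (\<xi> \<omega>) B) N S A"
    and h: "h \<in> borel_measurable borel" "distr unit_uniform borel h = distr M borel (\<lambda>\<omega>. S \<omega> 0)"
    and D: "matches_representations M W \<xi> B D"
  shows "D = distr (PiM UNIV (\<lambda>_. unit_uniform)) matrix_space (threshold_matrix (pullback_graphon W h))"
proof -
  let ?P = "PiM (UNIV :: nat set) (\<lambda>_. unit_uniform)" and ?R = "threshold_matrix (pullback_graphon W h)"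
  interpret prob_space M by fact
  have P: "prob_space ?P" by (rule prob_space_PiM) (rule prob_space_unit_uniform)
  have setsP: "sets ?P = sets (PiM UNIV (\<lambda>_. borel))" by (rule sets_PiM_cong) auto
  have R: "?R \<in> ?P \<rightarrow>\<^sub>M matrix_space"
    unfolding measurable_cong_sets[OF setsP refl]
    by (rule measurable_threshold_matrix[OF pullback_graphon_kernel[OF W h(1)]])
  have A: "A \<in> M \<rightarrow>\<^sub>M matrix_space"
    using rep by (auto simp: iid_representation_def graph_representation_def adjacency_representation_def)
  show ?thesis
  proof (rule matrix_law_eqI)
    show "prob_space D" "sets D = sets matrix_space"
      using D by (auto simp: matches_representations_def jointly_exchangeable_law_def)
    fix n :: nat
    assume n: "1 \<le> n"
    let ?E = "{\<omega> \<in> space M. N \<omega> = enat n}"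
    have pos: "measure M ?E \<noteq> 0"
      by (rule matches_representations_positive[OF assms(1) rep D n])
    have corner: "corner n \<in> matrix_space \<rightarrow>\<^sub>M corner_space n"
      by (rule measurable_restrict_subset) simp
    have "distr D (corner_space n) (corner n)
        = distr (uniform_measure M ?E) (corner_space n) (\<lambda>\<omega>. corner n (A \<omega>))"
    proof -
      have "\<forall>n\<ge>1. distr (uniform_measure M {\<omega> \<in> space M. N \<omega> = enat n}) (corner_space n) (\<lambda>\<omega>. corner n (A \<omega>))
          = distr D (corner_space n) (corner n)"
        using D[unfolded matches_representations_def, THEN conjunct2] rep by blast
      with n show ?thesis by simp
    qed
    also have "\<dots> = distr ?P (corner_space n) (\<lambda>u. corner n (?R u))"
    proof (rule corner_law_eqI[where M = "uniform_measure M ?E" and R = A and M' = ?P and R' = ?R and n = n,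
          OF _ _ _ P R threshold_matrix_simple[OF W h(1)]])
      show "AE \<omega> in uniform_measure M ?E. simple_graph_on n (A \<omega>)"
        by (rule iid_representation_simple[OF assms(1) rep])
      show "prob_space (uniform_measure M ?E)"
        using pos by (intro prob_space_uniform_measure) (auto simp: emeasure_eq_measure)
      show "A \<in> uniform_measure M ?E \<rightarrow>\<^sub>M matrix_space"
        using A by simp
      show "measure (uniform_measure M ?E) {\<omega> \<in> space (uniform_measure M ?E). \<forall>p\<in>upper n. A \<omega> p = b p}
          = measure ?P {u \<in> space ?P. \<forall>p\<in>upper n. ?R u p = b p}" for b
        using iid_representation_upper_probability[OF assms(1) W rep pos, of b]
          threshold_matrix_upper_probability[OF W h(1), of n b] h(2) by simp
    qed
    also have "\<dots> = distr (distr ?P matrix_space ?R) (corner_space n) (corner n)"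
      using distr_distr[OF corner R] by (simp add: comp_def)
    finally show "distr D (corner_space n) (corner n) = distr (distr ?P matrix_space ?R) (corner_space n) (corner n)" .
  qed simp
qed

text \<open>
  Richness speaks of sequences of reals, so the array is listed along the pairing function with its
  entries as \<open>0\<close> and \<open>1\<close>.
\<close>

lemma rich_realises_matrix_law:
  fixes R :: "(nat \<Rightarrow> real) \<Rightarrow> nat \<times> nat \<Rightarrow> bool"
  assumes "rich M" and A: "A \<in> M \<rightarrow>\<^sub>M matrix_space"
    and R: "R \<in> PiM UNIV (\<lambda>_. borel) \<rightarrow>\<^sub>M matrix_space"
    and law: "distr M matrix_space A = distr (PiM UNIV (\<lambda>_. unit_uniform)) matrix_space R"
  obtains U where "iid_uniform M U UNIV" "AE \<omega> in M. A \<omega> = R (\<lambda>k. U k \<omega>)"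
proof -
  let ?L = "PiM (UNIV :: nat set) (\<lambda>_. borel :: real measure)" and ?P = "PiM (UNIV :: nat set) (\<lambda>_. unit_uniform)"
  define code where "code a k = (of_bool (a (prod_decode k)) :: real)" for a :: "nat \<times> nat \<Rightarrow> bool" and k
  have code: "code \<in> matrix_space \<rightarrow>\<^sub>M ?L"
  proof (rule measurable_PiM_single')
    fix k
    have "(\<lambda>a. a (prod_decode k)) \<in> matrix_space \<rightarrow>\<^sub>M count_space UNIV"
      by (rule measurable_component_singleton) simp
    then show "(\<lambda>a. code a k) \<in> borel_measurable matrix_space"
      unfolding code_def by measurable
  qed simp
  have inj: "a = a'" if "code a = code a'" for a a'
  proof
    fix p
    have "code a (prod_encode p) = code a' (prod_encode p)" using that by simp
    then show "a p = a' p" by (cases "a p"; cases "a' p") (simp_all add: code_def)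
  qed
  have setsP: "sets ?P = sets ?L" by (rule sets_PiM_cong) auto
  have RP: "R \<in> ?P \<rightarrow>\<^sub>M matrix_space" using R unfolding measurable_cong_sets[OF setsP refl] .
  have "distr M ?L (code \<circ> A) = distr (distr M matrix_space A) ?L code"
    by (rule distr_distr[OF code A, symmetric])
  also have "\<dots> = distr ?P ?L (code \<circ> R)"
    unfolding law by (rule distr_distr[OF code RP])
  finally have "distr M ?L (code \<circ> A) = distr ?P ?L (code \<circ> R)" .
  moreover have "code \<circ> A \<in> M \<rightarrow>\<^sub>M ?L" "code \<circ> R \<in> ?L \<rightarrow>\<^sub>M ?L"
    using measurable_comp[OF A code] measurable_comp[OF R code] by auto
  ultimately obtain U where "iid_uniform M U UNIV" "AE \<omega> in M. (code \<circ> A) \<omega> = (code \<circ> R) (\<lambda>k. U k \<omega>)"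
    using assms(1) unfolding rich_def by blast
  then show thesis
    by (intro that[of U]) (auto elim!: eventually_mono intro: inj)
qed

theorem proposition23:
  fixes M :: "'w measure"
    and W :: "'a::polish_space \<times> 'a \<Rightarrow> real"
    and \<xi> :: "'w \<Rightarrow> (('a \<times> 'a) \<times> bool) measure"
    and \<nu> :: "'w \<Rightarrow> 'a measure"
    and B :: "'a set"
  assumes "prob_space M" and "rich M"
    and "boundedly_exchangeable M W \<xi> \<nu>"
    and "B \<in> sets borel" and "bounded B"
    and "\<P>(\<omega> in M. emeasure (\<nu> \<omega>) B = 0) < 1"
  shows "\<exists>W\<^sub>B. graphon W\<^sub>B \<and>
    (\<forall>A. associated_matrix M W \<xi> B A \<longrightarrow>
      (\<exists>U V. uniform_arrays M U V \<and>
        (AE \<omega> in M. \<forall>i j. A \<omega> (i, j) \<longleftrightarrow> V (i, j) \<omega> \<le> W\<^sub>B (U i \<omega>, U j \<omega>))))"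
proof (cases "\<exists>!D. matches_representations M W \<xi> B D")
  case False
  \<comment> \<open>No matrix is associated with \<open>\<xi>\<close> on \<open>B\<close>, and any graphon will do.\<close>
  have "graphon (\<lambda>_. 0)"
    by (rule connection_kernel_graphon) (simp add: connection_kernel_def)
  moreover have "\<not> associated_matrix M W \<xi> B A" for A
    using False by (auto simp: associated_matrix_def)
  ultimately show ?thesis by blast
next
  case True
  then obtain N S A\<^sub>0 where rep: "iid_representation M W (\<lambda>\<omega>. restrict_adjacency (\<xi> \<omega>) B) N S A\<^sub>0"
    by (rule unique_match_imp_representation)
  have W: "connection_kernel W"
    using assms(3) by (simp add: boundedly_exchangeable_def graph_process_def)
  have S: "S \<in> M \<rightarrow>\<^sub>M PiM UNIV (\<lambda>_. borel)"
    using rep by (auto simp: iid_representation_def graph_representation_def adjacency_representation_def)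
  have "(\<lambda>\<omega>. S \<omega> 0) \<in> borel_measurable M"
    by (rule measurable_compose[OF S measurable_component_singleton]) simp
  then have "prob_space (distr M borel (\<lambda>\<omega>. S \<omega> 0))"
    by (rule prob_space.prob_space_distr[OF assms(1)])
  then obtain h where h: "h \<in> borel_measurable borel" "distr unit_uniform borel h = distr M borel (\<lambda>\<omega>. S \<omega> 0)"
    by (rule uniform_realisation) simp
  let ?w = "pullback_graphon W h"
  have w: "connection_kernel ?w" by (rule pullback_graphon_kernel[OF W h(1)])
  have "\<exists>U V. uniform_arrays M U V \<and> (AE \<omega> in M. \<forall>i j. A \<omega> (i, j) \<longleftrightarrow> V (i, j) \<omega> \<le> ?w (U i \<omega>, U j \<omega>))"
    if A: "associated_matrix M W \<xi> B A" for A
  proof -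
    have A: "A \<in> M \<rightarrow>\<^sub>M matrix_space" and D: "matches_representations M W \<xi> B (distr M matrix_space A)"
      using A by (auto simp: associated_matrix_def)
    obtain X where X: "iid_uniform M X UNIV" "AE \<omega> in M. A \<omega> = threshold_matrix ?w (\<lambda>k. X k \<omega>)"
      by (rule rich_realises_matrix_law[OF assms(2) A measurable_threshold_matrix[OF w]
            associated_law_eq_threshold_law[OF assms(1) W rep h D]])
    from X(2) have "AE \<omega> in M. \<forall>i j. A \<omega> (i, j) \<longleftrightarrow> edge_array X (i, j) \<omega> \<le> ?w (vertex_array X i \<omega>, vertex_array X j \<omega>)"
      by eventually_elim (simp add: threshold_matrix_def vertex_array_def edge_array_def)
    with uniform_arrays_of_sequence[OF assms(1) X(1)] show ?thesis
      by (intro exI[of _ "vertex_array X"] exI[of _ "edge_array X"] conjI)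
  qed
  then show ?thesis
    by (intro exI[of _ ?w] conjI connection_kernel_graphon[OF w] allI impI)
qed

end
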